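(* Let $(U_k)_{k\ge1}$ be i.i.d. almost surely positive random variables distributed as $U$, with tail function $Q(x)=\mathbb{P}(U>x)$, and assume the following: the maximum of the support of the distribution of $U$ is $1$ and there exists $\alpha\in[0,2)$ such that $\log Q(1-u)=\alpha\log u+o(\log u)$ as $u\to0^+$. For each $N$, let $V_1\le\dots\le V_N$ be the order statistics of $(U_1,\dots,U_N)$ and, conditionally on $(V_1,\dots,V_N)$, let $(X_{i,j})_{1\le i<j\le N}$ be independent Bernoulli variables with $\mathbb{P}_V(X_{i,j}=1)=\frac{V_i}{V_i+V_j}$; set $X_{j,i}=1-X_{i,j}$ and $S_i=\sum_{j\ne i,\,1\le j\le N}X_{i,j}$. For $r\ge0$ let $G_r=\{\lceil N-r\rceil+1,\dots,N\}$ (the set of the $\lfloor r\rfloor$ strongest players). Then: (i) for any $\gamma<1-\alpha/2$, $\mathbb{P}$-almost surely, \[\mathbb{P}_V\Big(\max_{i\in G_{N^\gamma}}S_i<\max_{i\in G_N}S_i\Big)\xrightarrow[N\to\infty]{}1,\] i.e. with quenched probability tending to one none of the $N^\gamma$ best players wins; (ii) for any $\gamma>1-\alpha/2$, $\mathbb{P}$-almost surely, \[\mathbb{P}_V\Big(\max_{i\notin G_{N^\gamma}}S_i<\max_{i\in G_N}S_i\Big)\xrightarrow[N\to\infty]{}1,\] i.e. with quenched probability tending to one one of the $N^\gamma$ best players wins.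
   Context: $\mathbb{P}$ denotes the annealed probability (over the $U_k$ and the match outcomes) and $\mathbb{P}_V=\mathbb{P}(\,\cdot\mid V_1,\dots,V_N)$ the quenched probability given the strengths. $X_{i,j}=1$ means player $i$ beats player $j$, $S_i$ is the score of player $i$, and a winner is a player with maximal score. *)

theory Defs
  imports "HOL-Probability.Probability" "HOL-Library.Landau_Symbols"
begin

text \<open>Players are indexed 0..N-1 (player i+1 of the paper is player i here).
  A tournament outcome records, for each pair i < j < N, whether i beats j.\<close>

definition tournament_outcomes :: "nat \<Rightarrow> (nat \<Rightarrow> nat \<Rightarrow> bool) set" where
  "tournament_outcomes N = {x. \<forall>i j. x i j \<longrightarrow> i < j \<and> j < N}"

definition beats :: "(nat \<Rightarrow> nat \<Rightarrow> bool) \<Rightarrow> nat \<Rightarrow> nat \<Rightarrow> bool" where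
  "beats x i j = (if i < j then x i j else if j < i then \<not> x j i else False)"

definition score :: "nat \<Rightarrow> (nat \<Rightarrow> nat \<Rightarrow> bool) \<Rightarrow> nat \<Rightarrow> nat" where
  "score N x i = card {j. j < N \<and> j \<noteq> i \<and> beats x i j}"

text \<open>Probability of an outcome when the X_{i,j} (i<j) are independent Bernoulli
  with parameter V i / (V i + V j).\<close>
definition outcome_weight :: "nat \<Rightarrow> (nat \<Rightarrow> real) \<Rightarrow> (nat \<Rightarrow> nat \<Rightarrow> bool) \<Rightarrow> real" where
  "outcome_weight N V x =
     (\<Prod>(i,j)\<in>{(i,j). i < j \<and> j < N}.
        (if x i j then V i / (V i + V j) else V j / (V i + V j)))"

definition quenched_prob :: "nat \<Rightarrow> (nat \<Rightarrow> real) \<Rightarrow> ((nat \<Rightarrow> nat \<Rightarrow> bool) \<Rightarrow> bool) \<Rightarrow> real" where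
  "quenched_prob N V E = (\<Sum>x\<in>tournament_outcomes N. outcome_weight N V x * (if E x then 1 else 0))"

definition order_stats :: "(nat \<Rightarrow> real) \<Rightarrow> nat \<Rightarrow> nat \<Rightarrow> real" where
  "order_stats u N i = sort (map u [0..<N]) ! i"

text \<open>G_r = {ceil(N-r)+1, ..., N} in 1-based indexing, i.e. {ceil(N-r), ..., N-1} 0-based.\<close>
definition top_players :: "nat \<Rightarrow> real \<Rightarrow> nat set" where
  "top_players N r = {i. i < N \<and> \<lceil>real N - r\<rceil> \<le> int i}"

end

theory Submission
  imports Defs "HOL-Real_Asymp.Real_Asymp"
begin

text \<open>
  About \<open>N powr (1 - \<alpha> * \<beta>)\<close> players have a strength within \<open>N powr (- \<beta>)\<close> of the maximum, and a
  difference \<open>d\<close> in strength moves the expected score by order \<open>N * d\<close>, against fluctuations of order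
  \<open>sqrt N\<close>. The critical scale is therefore \<open>\<beta> = 1 / 2\<close>.

  If \<open>\<gamma> > 1 - \<alpha> / 2\<close>, every player outside the top \<open>N powr \<gamma>\<close> is weaker than the best one by more than
  \<open>N powr (\<epsilon> - 1 / 2)\<close>, and Hoeffding's inequality with a union bound excludes all of them.

  If \<open>\<gamma> < 1 - \<alpha> / 2\<close>, the top \<open>N powr \<gamma>\<close> players belong to a much larger group whose strengths differ
  by less than \<open>N powr (- 1 / 2 - \<epsilon>)\<close>. Exchanging the strengths of two members of this group changes
  the likelihood of an outcome by a bounded factor, so they are all about equally likely to be the
  sole winner. Each of them thus wins alone with a probability of the order of the inverse size of
  the group. Ties only cost a constant factor, because changing any one of the many defeats of a
  winner into a victory makes that player the sole winner. No precise large deviation estimate for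
  the maximal score is needed.
\<close>

section \<open>The quenched law\<close>

definition matches :: "nat \<Rightarrow> (nat \<times> nat) set" where
  "matches N = {(i, j). i < j \<and> j < N}"

lemma finite_matches [simp]: "finite (matches N)"
  by (rule finite_subset[of _ "{..<N} \<times> {..<N}"]) (auto simp: matches_def)

lemma tournament_outcomes_bij:
  "bij_betw (\<lambda>B i j. (i, j) \<in> B) (Pow (matches N)) (tournament_outcomes N)"
  by (rule bij_betwI[where g = "\<lambda>x. {(i, j). x i j}"])
     (auto simp: matches_def tournament_outcomes_def)

lemma finite_tournament_outcomes [simp]: "finite (tournament_outcomes N)"
  using bij_betw_finite[OF tournament_outcomes_bij[of N]] by simp

text \<open>Independence of the matches: a product of two-term sums expands into one term per set of
  matches won by the smaller index, and such sets are exactly the outcomes. Total mass one and the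
  factorisation of exponential moments both come from here.\<close>

lemma sum_prod_tournament_outcomes:
  fixes h :: "nat \<Rightarrow> nat \<Rightarrow> bool \<Rightarrow> real"
  shows "(\<Sum>x\<in>tournament_outcomes N. \<Prod>(i,j)\<in>matches N. h i j (x i j)) =
         (\<Prod>(i,j)\<in>matches N. h i j True + h i j False)"
proof -
  have "(\<Prod>(i,j)\<in>matches N. h i j ((i, j) \<in> B)) =
        (\<Prod>e\<in>B. h (fst e) (snd e) True) * (\<Prod>e\<in>matches N - B. h (fst e) (snd e) False)"
    if "B \<subseteq> matches N" for B
  proof -
    have "(\<Prod>(i,j)\<in>matches N. h i j ((i, j) \<in> B)) =
          (\<Prod>(i,j)\<in>matches N - B. h i j ((i, j) \<in> B)) * (\<Prod>(i,j)\<in>B. h i j ((i, j) \<in> B))"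
      using that by (intro prod.subset_diff) auto
    also have "(\<Prod>(i,j)\<in>matches N - B. h i j ((i, j) \<in> B)) =
               (\<Prod>e\<in>matches N - B. h (fst e) (snd e) False)"
      by (intro prod.cong) auto
    also have "(\<Prod>(i,j)\<in>B. h i j ((i, j) \<in> B)) = (\<Prod>e\<in>B. h (fst e) (snd e) True)"
      by (intro prod.cong) auto
    finally show ?thesis by simp
  qed
  then have "(\<Sum>x\<in>tournament_outcomes N. \<Prod>(i,j)\<in>matches N. h i j (x i j)) =
    (\<Sum>B\<in>Pow (matches N).
       (\<Prod>e\<in>B. h (fst e) (snd e) True) * (\<Prod>e\<in>matches N - B. h (fst e) (snd e) False))"
    unfolding sum.reindex_bij_betw[OF tournament_outcomes_bij, symmetric]
    by (intro sum.cong) auto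
  also have "\<dots> = (\<Prod>e\<in>matches N. h (fst e) (snd e) True + h (fst e) (snd e) False)"
    by (intro prod_add[symmetric]) simp
  finally show ?thesis by (simp add: case_prod_unfold)
qed

lemma outcome_weight_matches:
  "outcome_weight N V x = (\<Prod>(i,j)\<in>matches N.
     if x i j then V i / (V i + V j) else V j / (V i + V j))"
  by (simp add: outcome_weight_def matches_def)

lemma outcome_weight_pos:
  assumes "\<And>k. k < N \<Longrightarrow> 0 < V k"
  shows "0 < outcome_weight N V x"
  unfolding outcome_weight_matches
proof (rule prod_pos, clarify)
  fix i j assume "(i, j) \<in> matches N"
  with assms[of i] assms[of j] show "0 < (if x i j then V i / (V i + V j) else V j / (V i + V j))"
    by (auto simp: matches_def intro!: divide_pos_pos)
qed

lemma quenched_prob_True: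
  assumes "\<And>k. k < N \<Longrightarrow> 0 < V k"
  shows "quenched_prob N V (\<lambda>_. True) = 1"
proof -
  have "quenched_prob N V (\<lambda>_. True) = (\<Prod>(i,j)\<in>matches N. V i / (V i + V j) + V j / (V i + V j))"
    unfolding quenched_prob_def outcome_weight_matches
    using sum_prod_tournament_outcomes[of "\<lambda>i j b. if b then V i / (V i + V j) else V j / (V i + V j)" N]
    by simp
  also have "\<dots> = 1"
  proof (rule prod.neutral, clarify)
    fix i j assume "(i, j) \<in> matches N"
    with assms[of i] assms[of j] show "V i / (V i + V j) + V j / (V i + V j) = 1"
      by (auto simp: matches_def add_divide_distrib[symmetric])
  qed
  finally show ?thesis .
qed

lemma quenched_prob_mono:
  assumes "\<And>k. k < N \<Longrightarrow> 0 < V k"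
    and "\<And>x. x \<in> tournament_outcomes N \<Longrightarrow> E x \<Longrightarrow> F x"
  shows "quenched_prob N V E \<le> quenched_prob N V F"
  unfolding quenched_prob_def
  by (intro sum_mono mult_left_mono less_imp_le[OF outcome_weight_pos] assms(1))
     (auto simp: assms(2))

lemma quenched_prob_nonneg:
  assumes "\<And>k. k < N \<Longrightarrow> 0 < V k"
  shows "0 \<le> quenched_prob N V E"
  unfolding quenched_prob_def
  by (intro sum_nonneg mult_nonneg_nonneg less_imp_le[OF outcome_weight_pos] assms) auto

lemma quenched_prob_le_1:
  assumes "\<And>k. k < N \<Longrightarrow> 0 < V k"
  shows "quenched_prob N V E \<le> 1"
  using quenched_prob_mono[of N V E "\<lambda>_. True"] quenched_prob_True[of N V] assms by simp

lemma quenched_prob_not: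
  assumes "\<And>k. k < N \<Longrightarrow> 0 < V k"
  shows "quenched_prob N V (\<lambda>x. \<not> E x) = 1 - quenched_prob N V E"
proof -
  have "quenched_prob N V E + quenched_prob N V (\<lambda>x. \<not> E x) = quenched_prob N V (\<lambda>_. True)"
    unfolding quenched_prob_def sum.distrib[symmetric] by (intro sum.cong) auto
  with quenched_prob_True[of N V] assms show ?thesis by simp
qed

lemma quenched_prob_union:
  assumes "\<And>k. k < N \<Longrightarrow> 0 < V k" and "finite I"
    and "\<And>x. x \<in> tournament_outcomes N \<Longrightarrow> E x \<Longrightarrow> \<exists>i\<in>I. F i x"
  shows "quenched_prob N V E \<le> (\<Sum>i\<in>I. quenched_prob N V (F i))"
proof -
  have "quenched_prob N V E \<le> 
    (\<Sum>x\<in>tournament_outcomes N. \<Sum>i\<in>I. outcome_weight N V x * (if F i x then 1 else 0))"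
    unfolding quenched_prob_def
  proof (rule sum_mono)
    fix x assume x: "x \<in> tournament_outcomes N"
    have w: "0 \<le> outcome_weight N V x"
      using outcome_weight_pos[of N V x] assms(1) by simp
    show "outcome_weight N V x * (if E x then 1 else 0) \<le>
          (\<Sum>i\<in>I. outcome_weight N V x * (if F i x then 1 else 0))"
    proof (cases "E x")
      case True
      with assms(3) x obtain i where i: "i \<in> I" "F i x" by blast
      have "outcome_weight N V x * (if F i x then 1 else 0) \<le>
            (\<Sum>i\<in>I. outcome_weight N V x * (if F i x then 1 else 0))"
        using i w assms(2) by (intro member_le_sum) auto
      with i True show ?thesis by simp
    qed (auto intro!: sum_nonneg w)
  qed
  also have "\<dots> = (\<Sum>i\<in>I. quenched_prob N V (F i))"
    unfolding quenched_prob_def by (rule sum.swap)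
  finally show ?thesis .
qed

lemma quenched_prob_disjoint:
  assumes "\<And>k. k < N \<Longrightarrow> 0 < V k" and "finite I"
    and "\<And>x i j. i \<in> I \<Longrightarrow> j \<in> I \<Longrightarrow> F i x \<Longrightarrow> F j x \<Longrightarrow> i = j"
  shows "(\<Sum>i\<in>I. quenched_prob N V (F i)) \<le> 1"
proof -
  have "(\<Sum>i\<in>I. quenched_prob N V (F i)) =
    (\<Sum>x\<in>tournament_outcomes N. outcome_weight N V x * (\<Sum>i\<in>I. if F i x then 1 else 0))"
    unfolding quenched_prob_def sum_distrib_left by (rule sum.swap)
  also have "\<dots> \<le> (\<Sum>x\<in>tournament_outcomes N. outcome_weight N V x * (if True then 1 else 0))"
  proof (intro sum_mono mult_left_mono less_imp_le[OF outcome_weight_pos] assms(1))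
    fix x
    have "{i \<in> I. F i x} \<subseteq> {THE i. i \<in> I \<and> F i x}"
      using assms(3) by (force intro!: the_equality[symmetric])
    then have "card {i \<in> I. F i x} \<le> 1"
      by (metis card_mono finite.emptyI finite.insertI
          is_singletonI is_singleton_altdef)
    then show "(\<Sum>i\<in>I. if F i x then 1 else 0) \<le> (if True then 1 else (0::real))"
      using assms(2) by (simp add: sum.If_cases Int_def)
  qed
  also have "\<dots> = 1"
    using quenched_prob_True[of N V] assms(1) by (simp add: quenched_prob_def)
  finally show ?thesis .
qed

section \<open>Exponential moments and Hoeffding's inequality for the matches\<close>

text \<open>Markov's inequality for the exponential of \<open>s\<close> times a sum with one term
  per match; by independence the exponential moment is a product over the matches.\<close>

lemma quenched_prob_chernoff:
  fixes a :: "nat \<Rightarrow> nat \<Rightarrow> bool \<Rightarrow> real"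
  assumes pos: "\<And>k. k < N \<Longrightarrow> 0 < V k" and "0 \<le> s"
    and E: "\<And>x. x \<in> tournament_outcomes N \<Longrightarrow> E x \<Longrightarrow> t \<le> (\<Sum>(i,j)\<in>matches N. a i j (x i j))"
  shows "quenched_prob N V E \<le> exp (- s * t) * (\<Prod>(i,j)\<in>matches N.
      V i / (V i + V j) * exp (s * a i j True) + V j / (V i + V j) * exp (s * a i j False))"
proof -
  define h where "h = (\<lambda>i j b. (if b then V i / (V i + V j) else V j / (V i + V j)) *
                              exp (s * a i j b))"
  have "quenched_prob N V E \<le> (\<Sum>x\<in>tournament_outcomes N.
      outcome_weight N V x * (exp (- s * t) * exp (s * (\<Sum>(i,j)\<in>matches N. a i j (x i j)))))"
    unfolding quenched_prob_def
  proof (intro sum_mono mult_left_mono less_imp_le[OF outcome_weight_pos] pos)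
    fix x assume "x \<in> tournament_outcomes N"
    then have "s * t \<le> s * (\<Sum>(i,j)\<in>matches N. a i j (x i j))" if "E x"
      using that E assms(2) by (intro mult_left_mono) auto
    then show "(if E x then 1 else 0) \<le>
        exp (- s * t) * exp (s * (\<Sum>(i,j)\<in>matches N. a i j (x i j)))"
      by (auto simp flip: exp_add)
  qed
  also have "\<dots> = (\<Sum>x\<in>tournament_outcomes N.
      exp (- s * t) * (\<Prod>(i,j)\<in>matches N. h i j (x i j)))"
  proof (rule sum.cong[OF refl])
    fix x
    have "exp (s * (\<Sum>(i,j)\<in>matches N. a i j (x i j))) = (\<Prod>(i,j)\<in>matches N. exp (s * a i j (x i j)))"
      by (simp add: sum_distrib_left exp_sum case_prod_unfold)
    then show "outcome_weight N V x * (exp (- s * t) * exp (s * (\<Sum>(i,j)\<in>matches N. a i j (x i j))))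
      = exp (- s * t) * (\<Prod>(i,j)\<in>matches N. h i j (x i j))"
      by (simp add: outcome_weight_matches h_def case_prod_unfold prod.distrib)
  qed
  also have "\<dots> = exp (- s * t) * (\<Prod>(i,j)\<in>matches N. h i j True + h i j False)"
    by (simp add: sum_distrib_left[symmetric] sum_prod_tournament_outcomes)
  finally show ?thesis by (simp add: h_def)
qed

lemma bernoulli_mgf_le:
  fixes p d :: real
  assumes "0 \<le> p" "p \<le> 1"
  shows "p * exp d + (1 - p) \<le> exp (p * d + d\<^sup>2 / 8)"
proof -
  have *: "p * exp d + (1 - p) \<le> exp (p * d + d\<^sup>2 / 8)" if "0 \<le> p" "p \<le> 1" "0 \<le> d" for p d :: real
  proof -
    have "1 + p * (exp d - 1) > 0"
      using that by (intro add_pos_nonneg mult_nonneg_nonneg) auto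
    moreover have "ln (1 + p * (exp d - 1)) \<le> p * d + d\<^sup>2 / 8"
      using Hoeffdings_lemma_aux[of d p] that by (simp add: mult.commute)
    ultimately have "1 + p * (exp d - 1) \<le> exp (p * d + d\<^sup>2 / 8)"
      by (metis exp_ln exp_le_cancel_iff)
    then show ?thesis by (simp add: algebra_simps)
  qed
  show ?thesis
  proof (cases "0 \<le> d")
    \<comment> \<open>For negative \<open>d\<close>, exchange success and failure:
      \<open>exp d\<close> factors out, and the nonnegative case applies to \<open>1 - p\<close> and
      \<open>- d\<close>.\<close>
    case False
    have "p * exp d + (1 - p) = exp d * ((1 - p) * exp (- d) + (1 - (1 - p)))"
      by (simp add: algebra_simps exp_minus_inverse)
    also have "\<dots> \<le> exp d * exp ((1 - p) * (- d) + (- d)\<^sup>2 / 8)"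
      using False assms by (intro mult_left_mono *) auto
    also have "\<dots> = exp (p * d + d\<^sup>2 / 8)"
      by (simp add: exp_add[symmetric] algebra_simps)
    finally show ?thesis .
  qed (use * assms in blast)
qed

text \<open>Hoeffding's lemma for two arbitrary values: factoring out \<open>exp b\<close> leaves a
  Bernoulli variable scaled by \<open>a - b\<close>.\<close>

lemma bernoulli_mgf_le':
  fixes v w :: real
  assumes "0 < v" "0 < w"
  shows "v / (v + w) * exp a + w / (v + w) * exp b \<le>
         exp (v / (v + w) * a + w / (v + w) * b + (a - b)\<^sup>2 / 8)"
proof -
  define p where "p = v / (v + w)"
  have p: "0 \<le> p" "p \<le> 1" and q: "w / (v + w) = 1 - p"
    using assms by (auto simp: p_def field_simps)
  have "p * exp a + (1 - p) * exp b = exp b * (p * exp (a - b) + (1 - p))"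
    by (simp add: algebra_simps exp_diff)
  also have "\<dots> \<le> exp b * exp (p * (a - b) + (a - b)\<^sup>2 / 8)"
    by (intro mult_left_mono bernoulli_mgf_le p) auto
  also have "\<dots> = exp (p * a + (1 - p) * b + (a - b)\<^sup>2 / 8)"
    by (simp add: exp_add[symmetric] algebra_simps)
  finally show ?thesis by (simp add: q p_def[symmetric])
qed

text \<open>The range of the summand may vary with the match, because the bound serves both scores
  and log-likelihood ratios; \<open>D\<close> controls the sum of the squared ranges.\<close>

lemma quenched_prob_hoeffding:
  fixes a :: "nat \<Rightarrow> nat \<Rightarrow> bool \<Rightarrow> real"
  assumes pos: "\<And>k. k < N \<Longrightarrow> 0 < V k" and "0 \<le> t" "0 < D"
    and D: "(\<Sum>(i,j)\<in>matches N. (a i j True - a i j False)\<^sup>2) \<le> D"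
    and E: "\<And>x. x \<in> tournament_outcomes N \<Longrightarrow> E x \<Longrightarrow>
       (\<Sum>(i,j)\<in>matches N. V i / (V i + V j) * a i j True + V j / (V i + V j) * a i j False) + t
         \<le> (\<Sum>(i,j)\<in>matches N. a i j (x i j))"
  shows "quenched_prob N V E \<le> exp (- 2 * t\<^sup>2 / D)"
proof -
  \<comment> \<open>This \<open>s\<close> minimises the exponent
    \<open>- s * t + s\<^sup>2 * D / 8\<close>.\<close>
  define s where "s = 4 * t / D"
  have s: "0 \<le> s" using assms by (simp add: s_def)
  define \<mu> where "\<mu> = (\<lambda>i j. V i / (V i + V j) * a i j True + V j / (V i + V j) * a i j False)"
  have E': "x \<in> tournament_outcomes N \<Longrightarrow> E x \<Longrightarrow>
      (\<Sum>(i,j)\<in>matches N. \<mu> i j) + t \<le> (\<Sum>(i,j)\<in>matches N. a i j (x i j))" for x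
    using E unfolding \<mu>_def .
  have "quenched_prob N V E \<le> exp (- s * ((\<Sum>(i,j)\<in>matches N. \<mu> i j) + t)) * (\<Prod>(i,j)\<in>matches N.
      V i / (V i + V j) * exp (s * a i j True) + V j / (V i + V j) * exp (s * a i j False))"
    by (rule quenched_prob_chernoff[OF pos s E'])
  also have "\<dots> \<le> exp (- s * ((\<Sum>(i,j)\<in>matches N. \<mu> i j) + t)) * (\<Prod>(i,j)\<in>matches N.
      exp (s * \<mu> i j + s\<^sup>2 * (a i j True - a i j False)\<^sup>2 / 8))"
  proof (intro mult_left_mono prod_mono, clarify)
    fix i j assume "(i, j) \<in> matches N"
    with pos have v: "0 < V i" "0 < V j" by (auto simp: matches_def)
    have "s * \<mu> i j + s\<^sup>2 * (a i j True - a i j False)\<^sup>2 / 8 =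
      V i / (V i + V j) * (s * a i j True) + V j / (V i + V j) * (s * a i j False) +
      (s * a i j True - s * a i j False)\<^sup>2 / 8"
      by (simp add: \<mu>_def algebra_simps power2_eq_square)
    then show "0 \<le> V i / (V i + V j) * exp (s * a i j True) + V j / (V i + V j) * exp (s * a i j False)
      \<and> V i / (V i + V j) * exp (s * a i j True) + V j / (V i + V j) * exp (s * a i j False)
       \<le> exp (s * \<mu> i j + s\<^sup>2 * (a i j True - a i j False)\<^sup>2 / 8)"
      using bernoulli_mgf_le'[OF v] v by (auto intro!: add_nonneg_nonneg)
  qed auto
  also have "\<dots> = exp (- s * t + s\<^sup>2 / 8 * (\<Sum>(i,j)\<in>matches N. (a i j True - a i j False)\<^sup>2))"
    by (simp add: case_prod_unfold exp_sum[symmetric] exp_add[symmetric] sum.distrib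
        sum_distrib_left sum_negf algebra_simps)
  also have "\<dots> \<le> exp (- s * t + s\<^sup>2 / 8 * D)"
    using D by (simp add: mult_left_mono)
  also have "- s * t + s\<^sup>2 / 8 * D = - 2 * t\<^sup>2 / D"
    using \<open>0 < D\<close> by (simp add: s_def power2_eq_square field_simps)
  finally show ?thesis .
qed

section \<open>Scores and winners\<close>

text \<open>A match of player \<open>i\<close> is determined by the opponent \<open>k\<close> and is
  stored as \<open>(min i k, max i k)\<close>.\<close>

lemma sum_matches_incident:
  fixes F :: "nat \<Rightarrow> real"
  assumes "i < N"
  shows "(\<Sum>(a,b)\<in>matches N. if a = i then F b else if b = i then F a else 0) =
         (\<Sum>k\<in>{..<N} - {i}. F k)"
proof -
  have "(\<Sum>k\<in>{..<N} - {i}. F k) =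
        (\<Sum>(a,b)\<in>{(a, b) \<in> matches N. a = i \<or> b = i}. if a = i then F b else F a)"
    by (rule sum.reindex_bij_witness[where i = "\<lambda>(a, b). if a = i then b else a"
          and j = "\<lambda>k. (min i k, max i k)"])
       (use assms in \<open>auto simp: matches_def min_def max_def split: if_splits\<close>)
  also have "\<dots> = (\<Sum>(a,b)\<in>matches N. if a = i then F b else if b = i then F a else 0)"
    by (rule sum.mono_neutral_cong_left) (auto split: if_splits)
  finally show ?thesis by simp
qed

text \<open>Indexing by all matches rather than by opponents makes a score a sum of independent
  terms and lets two scores be subtracted match by match.\<close>

definition score_term :: "nat \<Rightarrow> nat \<Rightarrow> nat \<Rightarrow> bool \<Rightarrow> real" where
  "score_term i a b v = (if a = i then of_bool v else if b = i then of_bool (\<not> v) else 0)"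

definition expected_score :: "nat \<Rightarrow> (nat \<Rightarrow> real) \<Rightarrow> nat \<Rightarrow> real" where
  "expected_score N V i = (\<Sum>k\<in>{..<N} - {i}. V i / (V i + V k))"

lemma score_eq_sum:
  assumes "i < N"
  shows "real (score N x i) = (\<Sum>(a,b)\<in>matches N. score_term i a b (x a b))"
proof -
  have "(\<Sum>(a,b)\<in>matches N. score_term i a b (x a b)) =
        (\<Sum>(a,b)\<in>matches N. if a = i then of_bool (beats x i b)
            else if b = i then of_bool (beats x i a) else 0)"
    by (intro sum.cong) (auto simp: matches_def score_term_def beats_def)
  also have "\<dots> = (\<Sum>k\<in>{..<N} - {i}. of_bool (beats x i k))"
    by (rule sum_matches_incident[OF assms])
  also have "\<dots> = real (card {k \<in> {..<N} - {i}. beats x i k})"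
    by (simp add: of_bool_def sum.If_cases Int_def)
  also have "{k \<in> {..<N} - {i}. beats x i k} = {j. j < N \<and> j \<noteq> i \<and> beats x i j}"
    by auto
  finally show ?thesis by (simp add: score_def)
qed

lemma expected_score_eq_sum:
  assumes "i < N"
  shows "(\<Sum>(a,b)\<in>matches N. V a / (V a + V b) * score_term i a b True +
             V b / (V a + V b) * score_term i a b False) = expected_score N V i"
proof -
  have "(\<Sum>(a,b)\<in>matches N. V a / (V a + V b) * score_term i a b True +
             V b / (V a + V b) * score_term i a b False) =
        (\<Sum>(a,b)\<in>matches N. if a = i then V i / (V i + V b)
            else if b = i then V i / (V i + V a) else 0)"
    by (intro sum.cong) (auto simp: matches_def score_term_def add.commute)
  also have "\<dots> = expected_score N V i"
    unfolding expected_score_def by (rule sum_matches_incident[OF assms])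
  finally show ?thesis .
qed

lemma sum_score_term_range:
  assumes "i < N"
  shows "(\<Sum>(a,b)\<in>matches N. (score_term i a b True - score_term i a b False)\<^sup>2) \<le> real N"
proof -
  have "(\<Sum>(a,b)\<in>matches N. (score_term i a b True - score_term i a b False)\<^sup>2) =
        (\<Sum>(a,b)\<in>matches N. if a = i then 1 else if b = i then 1 else 0)"
    by (intro sum.cong) (auto simp: score_term_def)
  also have "\<dots> = (\<Sum>k\<in>{..<N} - {i}. 1)"
    by (rule sum_matches_incident[OF assms])
  also have "\<dots> \<le> real N" using assms by simp
  finally show ?thesis .
qed

lemma score_tail:
  assumes pos: "\<And>k. k < N \<Longrightarrow> 0 < V k" and i: "i < N" and t: "0 \<le> t"
  shows "quenched_prob N V (\<lambda>x. expected_score N V i + t \<le> real (score N x i))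
           \<le> exp (- 2 * t\<^sup>2 / real N)"
proof (rule quenched_prob_hoeffding[where a = "score_term i", OF pos t])
  show "(\<Sum>(a,b)\<in>matches N. (score_term i a b True - score_term i a b False)\<^sup>2) \<le> real N"
    by (rule sum_score_term_range[OF i])
next
  fix x assume "expected_score N V i + t \<le> real (score N x i)"
  then show "(\<Sum>(a,b)\<in>matches N. V a / (V a + V b) * score_term i a b True +
      V b / (V a + V b) * score_term i a b False) + t \<le> (\<Sum>(a,b)\<in>matches N. score_term i a b (x a b))"
    by (simp only: expected_score_eq_sum[OF i] score_eq_sum[OF i])
qed (use i in auto)

text \<open>Hoeffding's inequality for the difference of the two scores. Bounding
  \<open>(y - z)\<^sup>2\<close> by \<open>2 * y\<^sup>2 + 2 * z\<^sup>2\<close> also covers the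
  match between \<open>i\<close> and \<open>j\<close>, which enters both scores, and gives squared
  ranges of total at most \<open>4 * N\<close>.\<close>

lemma score_upset_tail:
  assumes pos: "\<And>k. k < N \<Longrightarrow> 0 < V k" and i: "i < N" and j: "j < N" and t: "0 \<le> t"
    and gap: "expected_score N V i + t \<le> expected_score N V j"
  shows "quenched_prob N V (\<lambda>x. score N x j \<le> score N x i) \<le> exp (- t\<^sup>2 / (2 * real N))"
proof -
  define a where "a = (\<lambda>k l v. score_term i k l v - score_term j k l v)"
  have "(\<Sum>(k,l)\<in>matches N. (a k l True - a k l False)\<^sup>2) \<le>
     (\<Sum>(k,l)\<in>matches N. 2 * (score_term i k l True - score_term i k l False)\<^sup>2 +
                         2 * (score_term j k l True - score_term j k l False)\<^sup>2)"
  proof (intro sum_mono, clarify)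
    fix k l
    have "(y - z)\<^sup>2 \<le> 2 * y\<^sup>2 + 2 * z\<^sup>2" for y z :: real
      using zero_le_power2[of "y + z"] by (simp add: power2_eq_square algebra_simps)
    from this[of "score_term i k l True - score_term i k l False"
        "score_term j k l True - score_term j k l False"]
    show "(a k l True - a k l False)\<^sup>2 \<le>
       2 * (score_term i k l True - score_term i k l False)\<^sup>2 +
       2 * (score_term j k l True - score_term j k l False)\<^sup>2"
      by (simp add: a_def algebra_simps)
  qed
  also have "\<dots> \<le> 4 * real N"
    using sum_score_term_range[OF i] sum_score_term_range[OF j]
    by (simp add: case_prod_unfold sum.distrib sum_distrib_left[symmetric])
  finally have D: "(\<Sum>(k,l)\<in>matches N. (a k l True - a k l False)\<^sup>2) \<le> 4 * real N" .
  have mean: "(\<Sum>(k,l)\<in>matches N. V k / (V k + V l) * a k l True + V l / (V k + V l) * a k l False)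
      = expected_score N V i - expected_score N V j"
    unfolding expected_score_eq_sum[OF i, symmetric] expected_score_eq_sum[OF j, symmetric]
    by (simp add: a_def case_prod_unfold sum_subtractf[symmetric] algebra_simps)
  have "(\<Sum>(k,l)\<in>matches N. a k l (x k l)) = real (score N x i) - real (score N x j)" for x
    unfolding score_eq_sum[OF i] score_eq_sum[OF j]
    by (simp add: a_def case_prod_unfold sum_subtractf)
  with gap have "quenched_prob N V (\<lambda>x. score N x j \<le> score N x i) \<le> exp (- 2 * t\<^sup>2 / (4 * real N))"
    by (intro quenched_prob_hoeffding[where a = a, OF pos t _ D]) (use i mean in auto)
  then show ?thesis by simp
qed

section \<open>Bounds on expected scores\<close>

text \<open>The chance \<open>v / (v + w)\<close> has derivative \<open>w / (v + w)\<^sup>2\<close>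
  in \<open>v\<close>, at least \<open>w / 4\<close> for strengths at most 1; the proof works with
  the exact difference of two such chances.\<close>

lemma expected_score_gap:
  assumes V: "\<And>k. k < N \<Longrightarrow> 0 < V k" "\<And>k. k < N \<Longrightarrow> V k \<le> 1"
    and i: "i < N" and j: "j < N" and d: "0 \<le> d" "V i + d \<le> V j"
  shows "expected_score N V i + d * (\<Sum>k<N. V k) / 4 \<le> expected_score N V j"
proof -
  \<comment> \<open>A fictitious match against oneself, worth 1 / 2, makes \<open>i\<close> and
    \<open>j\<close> sum over the same opponents.\<close>
  have full: "expected_score N V l = (\<Sum>k<N. V l / (V l + V k)) - 1 / 2" if "l < N" for l
    using sum.remove[of "{..<N}" l "\<lambda>k. V l / (V l + V k)"] that V(1)[of l]
    by (simp add: expected_score_def)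
  have "d * V k / 4 \<le> V j / (V j + V k) - V i / (V i + V k)" if k: "k < N" for k
  proof -
    have v: "0 < V i" "0 < V j" "0 < V k" "V i \<le> 1" "V j \<le> 1" "V k \<le> 1"
      using V i j k by auto
    have "d * V k / 4 \<le> d * V k / ((V j + V k) * (V i + V k))"
    proof (rule divide_left_mono)
      show "(V j + V k) * (V i + V k) \<le> 4"
        using mult_mono[of "V j + V k" 2 "V i + V k" 2] v by simp
    qed (use v d in auto)
    also have "\<dots> \<le> (V j - V i) * V k / ((V j + V k) * (V i + V k))"
      using v d by (intro divide_right_mono mult_right_mono) auto
    also have "\<dots> = V j / (V j + V k) - V i / (V i + V k)"
      using v by (simp add: field_simps)
    finally show ?thesis .
  qed
  then have "(\<Sum>k<N. d * V k / 4) \<le> (\<Sum>k<N. V j / (V j + V k) - V i / (V i + V k))"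
    by (intro sum_mono) auto
  then show ?thesis
    by (simp add: full[OF i] full[OF j] sum_subtractf sum_distrib_left sum_divide_distrib)
qed

text \<open>Strengths being at most 1, opponent \<open>k\<close> beats \<open>i\<close> with
  probability at least \<open>V k / 2\<close>. Hence even the best player is expected to lose a
  positive fraction of the matches once the total strength is linear in \<open>N\<close>.\<close>

lemma expected_score_le:
  assumes V: "\<And>k. k < N \<Longrightarrow> 0 < V k" "\<And>k. k < N \<Longrightarrow> V k \<le> 1" and i: "i < N"
  shows "expected_score N V i \<le> real N - 1 / 2 - (\<Sum>k<N. V k) / 2"
proof -
  have "expected_score N V i \<le> (\<Sum>k\<in>{..<N} - {i}. 1 - V k / 2)"
    unfolding expected_score_def
  proof (rule sum_mono)
    fix k assume k: "k \<in> {..<N} - {i}"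
    then have v: "0 < V i" "0 < V k" "V i \<le> 1" "V k \<le> 1" using V i by auto
    then have "V k / 2 \<le> V k / (V i + V k)"
      by (intro divide_left_mono) auto
    also have "\<dots> = 1 - V i / (V i + V k)"
      using v by (simp add: field_simps)
    finally show "V i / (V i + V k) \<le> 1 - V k / 2" by simp
  qed
  also have "\<dots> = real N - 1 - (\<Sum>k<N. V k) / 2 + V i / 2"
    using i by (simp add: sum_subtractf sum_divide_distrib[symmetric] sum_diff1 of_nat_diff diff_divide_distrib)
  also have "\<dots> \<le> real N - 1 / 2 - (\<Sum>k<N. V k) / 2"
    using V(2)[OF i] by simp
  finally show ?thesis .
qed

section \<open>Winners and the reversal of one defeat\<close>

definition is_winner :: "nat \<Rightarrow> (nat \<Rightarrow> nat \<Rightarrow> bool) \<Rightarrow> nat \<Rightarrow> bool" where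
  "is_winner N x i \<longleftrightarrow> (\<forall>k<N. score N x k \<le> score N x i)"

text \<open>Sole victories of different players exclude each other, so their probabilities add up to
  at most 1.\<close>

definition is_sole_winner :: "nat \<Rightarrow> (nat \<Rightarrow> nat \<Rightarrow> bool) \<Rightarrow> nat \<Rightarrow> bool" where
  "is_sole_winner N x i \<longleftrightarrow> (\<forall>k<N. k \<noteq> i \<longrightarrow> score N x k < score N x i)"

text \<open>Only the result of the smaller index against the larger one is stored: a victory of
  \<open>i\<close> over \<open>k\<close> is True in the entry \<open>x i k\<close> if
  \<open>i < k\<close>, and False in the entry \<open>x k i\<close> if \<open>k < i\<close>.\<close>

definition award :: "(nat \<Rightarrow> nat \<Rightarrow> bool) \<Rightarrow> nat \<Rightarrow> nat \<Rightarrow> (nat \<Rightarrow> nat \<Rightarrow> bool)" where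
  "award x i k = (\<lambda>a b. if a = i \<and> b = k \<and> i < k then True
                        else if a = k \<and> b = i \<and> k < i then False else x a b)"

lemma beats_award:
  assumes "i \<noteq> k"
  shows "beats (award x i k) a b =
    (if a = i \<and> b = k then True else if a = k \<and> b = i then False else beats x a b)"
  using assms by (auto simp: beats_def award_def)

lemma beats_antisym: "a \<noteq> b \<Longrightarrow> beats x a b \<longleftrightarrow> \<not> beats x b a"
  by (auto simp: beats_def)

lemma award_in_tournament_outcomes:
  assumes "x \<in> tournament_outcomes N" "i < N" "k < N"
  shows "award x i k \<in> tournament_outcomes N"
  using assms by (auto simp: tournament_outcomes_def award_def)

lemma score_award_self:
  assumes "i \<noteq> k" "k < N" "\<not> beats x i k"
  shows "score N (award x i k) i = Suc (score N x i)"
proof -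
  have "{j. j < N \<and> j \<noteq> i \<and> beats (award x i k) i j} =
        insert k {j. j < N \<and> j \<noteq> i \<and> beats x i j}"
    using assms by (auto simp: beats_award)
  then show ?thesis using assms by (simp add: score_def)
qed

lemma score_award_other:
  assumes "i \<noteq> k" "a \<noteq> i"
  shows "score N (award x i k) a \<le> score N x a"
  unfolding score_def using assms by (intro card_mono) (auto simp: beats_award split: if_splits)

text \<open>Player \<open>i\<close> gains a point and nobody else does, which breaks every
  tie.\<close>

lemma is_sole_winner_award:
  assumes "is_winner N x i" "i \<noteq> k" "k < N" "\<not> beats x i k"
  shows "is_sole_winner N (award x i k) i"
  unfolding is_sole_winner_def
proof (intro allI impI)
  fix a assume "a < N" "a \<noteq> i"
  then have "score N (award x i k) a \<le> score N x i"
    using score_award_other[of i k a N x] assms by (auto simp: is_winner_def intro: order_trans)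
  then show "score N (award x i k) a < score N (award x i k) i"
    using score_award_self[of i k N x] assms by simp
qed

text \<open>The weights differ only in the factor of the match between \<open>i\<close> and
  \<open>k\<close>, which passes from \<open>V k / (V i + V k)\<close> to
  \<open>V i / (V i + V k)\<close>.\<close>

lemma outcome_weight_award:
  assumes pos: "\<And>k. k < N \<Longrightarrow> 0 < V k" and ik: "i < N" "k < N" "i \<noteq> k" "\<not> beats x i k"
  shows "outcome_weight N V x * V i = outcome_weight N V (award x i k) * V k"
proof -
  define f where "f = (\<lambda>x (a, b). if x a b then V a / (V a + V b) else V b / (V a + V b))"
  define e where "e = (min i k, max i k)"
  have e: "e \<in> matches N" using ik by (auto simp: e_def matches_def min_def max_def)
  have w: "outcome_weight N V y = f y e * (\<Prod>d\<in>matches N - {e}. f y d)" for y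
    unfolding outcome_weight_matches using prod.remove[OF finite_matches e, of "f y"]
    by (simp add: f_def)
  have "(\<Prod>d\<in>matches N - {e}. f (award x i k) d) = (\<Prod>d\<in>matches N - {e}. f x d)"
    by (intro prod.cong) (auto simp: f_def award_def e_def split: if_splits)
  moreover have "f x e * V i = f (award x i k) e * V k"
    using ik by (cases "i < k") (auto simp: f_def award_def e_def beats_def add.commute)
  ultimately show ?thesis by (simp add: w mult_ac)
qed

text \<open>The overwritten result is known to be a defeat of \<open>i\<close>, so no information is
  lost.\<close>

lemma inj_on_award:
  assumes "i \<noteq> k"
  shows "inj_on (\<lambda>x. award x i k) {x. \<not> beats x i k}"
proof (rule inj_onI, clarify)
  fix x y assume *: "\<not> beats x i k" "\<not> beats y i k" and eq: "award x i k = award y i k"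
  show "x = y"
  proof (intro ext)
    fix a b
    show "x a b = y a b"
    proof (cases "(a = i \<and> b = k \<and> i < k) \<or> (a = k \<and> b = i \<and> k < i)")
      case True
      with * show ?thesis by (auto simp: beats_def)
    next
      case False
      with fun_cong[OF fun_cong[OF eq], of a b] show ?thesis by (auto simp: award_def)
    qed
  qed
qed

text \<open>Double counting of pairs of a victory of \<open>i\<close> and a defeat of
  \<open>i\<close> in it. Each such outcome has at least \<open>L\<close> defeats; for a fixed
  opponent, reversing the defeat maps injectively into sole victories of \<open>i\<close> and costs
  a factor at most \<open>R\<close> in weight. There are fewer than \<open>N\<close>
  opponents.\<close>

lemma quenched_prob_winner_le_sole_winner:
  assumes pos: "\<And>k. k < N \<Longrightarrow> 0 < V k" and i: "i < N" and "0 < L"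
    and R: "\<And>k. k < N \<Longrightarrow> V k \<le> R * V i" "0 \<le> R"
  shows "quenched_prob N V (\<lambda>x. is_winner N x i \<and> real (score N x i) \<le> real N - 1 - L) \<le>
         real N * R / L * quenched_prob N V (\<lambda>x. is_sole_winner N x i)"
proof -
  let ?T = "tournament_outcomes N" and ?w = "outcome_weight N V"
  let ?A = "\<lambda>x. is_winner N x i \<and> real (score N x i) \<le> real N - 1 - L"
  have w0: "0 \<le> ?w x" for x using outcome_weight_pos[of N V x] pos by simp
  have defeats: "L \<le> (\<Sum>k\<in>{..<N} - {i}. of_bool (\<not> beats x i k))"
    if "?A x" for x
  proof -
    have "(\<Sum>k\<in>{..<N} - {i}. of_bool (\<not> beats x i k)) =
          (\<Sum>k\<in>{..<N} - {i}. 1 - (of_bool (beats x i k) :: real))"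
      by (intro sum.cong) auto
    also have "\<dots> = real N - 1 - real (card {k \<in> {..<N} - {i}. beats x i k})"
      using i by (simp add: sum_subtractf of_bool_def sum.If_cases Int_def of_nat_diff)
    also have "{k \<in> {..<N} - {i}. beats x i k} = {j. j < N \<and> j \<noteq> i \<and> beats x i j}"
      by auto
    finally show ?thesis using that by (simp add: score_def)
  qed
  have one: "(\<Sum>x\<in>?T. ?w x * (if ?A x \<and> \<not> beats x i k then 1 else 0)) \<le>
             R * quenched_prob N V (\<lambda>x. is_sole_winner N x i)" if k: "k < N" "k \<noteq> i" for k
  proof -
    let ?B = "{x \<in> ?T. is_winner N x i \<and> \<not> beats x i k}"
    have "(\<Sum>x\<in>?T. ?w x * (if ?A x \<and> \<not> beats x i k then 1 else 0)) \<le>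
          (\<Sum>x\<in>?T. if is_winner N x i \<and> \<not> beats x i k then ?w x else 0)"
      using w0 by (intro sum_mono) auto
    also have "\<dots> = (\<Sum>x\<in>?B. ?w x)"
      by (simp add: sum.If_cases Int_def)
    also have "\<dots> \<le> (\<Sum>x\<in>?B. R * ?w (award x i k))"
    proof (rule sum_mono)
      fix x assume "x \<in> ?B"
      then have "?w x * V i = ?w (award x i k) * V k"
        using i k pos by (intro outcome_weight_award) auto
      also have "\<dots> \<le> ?w (award x i k) * (R * V i)"
        using R k w0 by (intro mult_left_mono) auto
      finally show "?w x \<le> R * ?w (award x i k)"
        using pos[OF i] by (simp add: mult.assoc[symmetric] mult.commute)
    qed
    also have "\<dots> = R * sum ?w ((\<lambda>x. award x i k) ` ?B)"
      using k by (subst sum.reindex)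
        (auto simp: sum_distrib_left intro: inj_on_subset[OF inj_on_award])
    also have "sum ?w ((\<lambda>x. award x i k) ` ?B) \<le> sum ?w {x \<in> ?T. is_sole_winner N x i}"
      using i k w0 by (intro sum_mono2)
        (auto intro: award_in_tournament_outcomes is_sole_winner_award)
    also have "\<dots> = quenched_prob N V (\<lambda>x. is_sole_winner N x i)"
      by (simp add: quenched_prob_def sum.If_cases Int_def if_distrib[of "\<lambda>z. _ * z"])
    finally show ?thesis using R by (simp add: mult_left_mono)
  qed
  have "L * quenched_prob N V ?A = (\<Sum>x\<in>?T. ?w x * (L * (if ?A x then 1 else 0)))"
    by (simp add: quenched_prob_def sum_distrib_left mult_ac)
  also have "\<dots> \<le> (\<Sum>x\<in>?T. ?w x * (\<Sum>k\<in>{..<N} - {i}. if ?A x \<and> \<not> beats x i k then 1 else 0))"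
  proof (intro sum_mono mult_left_mono w0)
    fix x
    show "L * (if ?A x then 1 else 0) \<le>
      (\<Sum>k\<in>{..<N} - {i}. if ?A x \<and> \<not> beats x i k then 1 else 0)"
    proof (cases "?A x")
      case True
      with defeats[OF True] show ?thesis by (simp add: of_bool_def)
    next
      case False
      then show ?thesis by (auto intro!: sum_nonneg)
    qed
  qed
  also have "\<dots> = (\<Sum>k\<in>{..<N} - {i}. \<Sum>x\<in>?T. ?w x * (if ?A x \<and> \<not> beats x i k then 1 else 0))"
    unfolding sum_distrib_left by (rule sum.swap)
  also have "\<dots> \<le> (\<Sum>k\<in>{..<N} - {i}. R * quenched_prob N V (\<lambda>x. is_sole_winner N x i))"
    by (intro sum_mono one) auto
  also have "\<dots> \<le> real N * R * quenched_prob N V (\<lambda>x. is_sole_winner N x i)"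
    using R quenched_prob_nonneg[of N V "\<lambda>x. is_sole_winner N x i"] pos i
    by (simp add: mult_right_mono mult.assoc)
  finally show ?thesis using \<open>0 < L\<close> by (simp add: field_simps)
qed

section \<open>Exchanging the strengths of two players\<close>

text \<open>Reading results through \<open>beats\<close> restores the storage of each match under
  its smaller index, since \<open>\<pi>\<close> need not preserve the order.\<close>

definition relabel :: "nat \<Rightarrow> (nat \<Rightarrow> nat) \<Rightarrow> (nat \<Rightarrow> nat \<Rightarrow> bool) \<Rightarrow> (nat \<Rightarrow> nat \<Rightarrow> bool)" where
  "relabel N \<pi> x = (\<lambda>a b. a < b \<and> b < N \<and> beats x (\<pi> a) (\<pi> b))"

lemma relabel_in_tournament_outcomes: "relabel N \<pi> x \<in> tournament_outcomes N"
  by (auto simp: relabel_def tournament_outcomes_def)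

lemma beats_relabel:
  assumes "inj \<pi>" "a < N" "b < N"
  shows "beats (relabel N \<pi> x) a b = beats x (\<pi> a) (\<pi> b)"
proof -
  consider "a < b" | "b < a" | "a = b" by linarith
  then show ?thesis
  proof cases
    case 2
    then have "\<pi> a \<noteq> \<pi> b" using assms(1) by (auto dest: injD)
    from beats_antisym[OF this, of x] show ?thesis
      using 2 assms unfolding beats_def[of "relabel N \<pi> x"] by (auto simp: relabel_def)
  qed (use assms in \<open>auto simp: beats_def relabel_def\<close>)
qed

lemma relabel_relabel:
  assumes "inj \<pi>" "\<And>k. \<pi> (\<pi> k) = k" "\<And>k. k < N \<Longrightarrow> \<pi> k < N" "x \<in> tournament_outcomes N"
  shows "relabel N \<pi> (relabel N \<pi> x) = x"
proof (intro ext)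
  fix a b
  show "relabel N \<pi> (relabel N \<pi> x) a b = x a b"
  proof (cases "a < b \<and> b < N")
    case True
    then have "relabel N \<pi> (relabel N \<pi> x) a b = beats x (\<pi> (\<pi> a)) (\<pi> (\<pi> b))"
      using assms(3)[of a] assms(3)[of b] beats_relabel[OF assms(1), of "\<pi> a" N "\<pi> b" x]
      by (simp add: relabel_def[of N \<pi> "relabel N \<pi> x"])
    with True assms(2) show ?thesis by (simp add: beats_def)
  qed (use assms(4) in \<open>auto simp: relabel_def tournament_outcomes_def\<close>)
qed

lemma score_relabel:
  assumes "inj \<pi>" "\<And>k. \<pi> (\<pi> k) = k" "\<And>k. k < N \<Longrightarrow> \<pi> k < N" "i < N"
  shows "score N (relabel N \<pi> x) i = score N x (\<pi> i)"
  unfolding score_def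
proof (rule bij_betw_same_card)
  show "bij_betw \<pi> {j. j < N \<and> j \<noteq> i \<and> beats (relabel N \<pi> x) i j}
           {j. j < N \<and> j \<noteq> \<pi> i \<and> beats x (\<pi> i) j}"
    by (rule bij_betwI[where g = \<pi>])
       (use assms in \<open>auto simp: beats_relabel dest: injD\<close>)
qed

lemma is_sole_winner_relabel:
  assumes "inj \<pi>" "\<And>k. \<pi> (\<pi> k) = k" "\<And>k. k < N \<Longrightarrow> \<pi> k < N" "i < N"
  shows "is_sole_winner N (relabel N \<pi> x) i \<longleftrightarrow> is_sole_winner N x (\<pi> i)"
proof -
  have "is_sole_winner N (relabel N \<pi> x) i \<longleftrightarrow>
        (\<forall>k<N. k \<noteq> i \<longrightarrow> score N x (\<pi> k) < score N x (\<pi> i))"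
    using assms by (simp add: is_sole_winner_def score_relabel)
  also have "\<dots> \<longleftrightarrow> is_sole_winner N x (\<pi> i)"
    unfolding is_sole_winner_def using assms(2,3) by metis
  finally show ?thesis .
qed

text \<open>In the square of the weight every pair of players occurs in both orders, so that relabelling the
  players merely permutes the factors.\<close>

lemma outcome_weight_square:
  "(outcome_weight N V x)\<^sup>2 = (\<Prod>(a,b)\<in>{(a, b). a < N \<and> b < N \<and> a \<noteq> b}.
      (if beats x a b then V a else V b) / (V a + V b))"
proof -
  define g where "g = (\<lambda>(a, b). (if beats x a b then V a else V b) / (V a + V b))"
  have w: "outcome_weight N V x = prod g (matches N)"
    unfolding outcome_weight_matches g_def
    by (intro prod.cong) (auto simp: matches_def beats_def)
  have w': "outcome_weight N V x = prod g (prod.swap ` matches N)"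
    unfolding outcome_weight_matches g_def
    by (subst prod.reindex)
       (auto simp: matches_def beats_def o_def add.commute intro!: prod.cong)
  have "prod g (matches N) * prod g (prod.swap ` matches N) =
        prod g (matches N \<union> prod.swap ` matches N)"
    by (intro prod.union_disjoint[symmetric]) (simp, simp, auto simp: matches_def)
  also have "matches N \<union> prod.swap ` matches N = {(a, b). a < N \<and> b < N \<and> a \<noteq> b}"
    by (auto simp: matches_def image_iff)
  finally show ?thesis using w w' by (simp add: power2_eq_square g_def)
qed

text \<open>Strengths and results move together. The squares agree because \<open>\<pi>\<close>
  permutes the ordered pairs of players, and positivity removes the square.\<close>

lemma outcome_weight_relabel:
  assumes pos: "\<And>k. k < N \<Longrightarrow> 0 < V k"
    and \<pi>: "inj \<pi>" "\<And>k. \<pi> (\<pi> k) = k" "\<And>k. k < N \<Longrightarrow> \<pi> k < N"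
  shows "outcome_weight N (V \<circ> \<pi>) (relabel N \<pi> x) = outcome_weight N V x"
proof -
  have "(outcome_weight N (V \<circ> \<pi>) (relabel N \<pi> x))\<^sup>2 = (outcome_weight N V x)\<^sup>2"
    unfolding outcome_weight_square
    by (rule prod.reindex_bij_witness[where i = "map_prod \<pi> \<pi>" and j = "map_prod \<pi> \<pi>"])
       (use \<pi> in \<open>auto simp: beats_relabel dest: injD\<close>)
  moreover have "0 < outcome_weight N (V \<circ> \<pi>) (relabel N \<pi> x)" "0 < outcome_weight N V x"
    using pos \<pi>(3) by (auto intro!: outcome_weight_pos)
  ultimately show ?thesis by (simp add: power2_eq_iff_nonneg)
qed

text \<open>Relabelling by an involution is its own inverse on outcomes, so it reindexes the sum
  that defines the probability.\<close>

lemma quenched_prob_relabel: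
  assumes pos: "\<And>k. k < N \<Longrightarrow> 0 < V k"
    and \<pi>: "inj \<pi>" "\<And>k. \<pi> (\<pi> k) = k" "\<And>k. k < N \<Longrightarrow> \<pi> k < N"
  shows "quenched_prob N (V \<circ> \<pi>) E = quenched_prob N V (\<lambda>x. E (relabel N \<pi> x))"
  unfolding quenched_prob_def
proof (rule sum.reindex_bij_witness[where i = "relabel N \<pi>" and j = "relabel N \<pi>"])
  fix x assume "x \<in> tournament_outcomes N"
  then show "outcome_weight N V (relabel N \<pi> x) * (if E (relabel N \<pi> (relabel N \<pi> x)) then 1 else 0) =
    outcome_weight N (V \<circ> \<pi>) x * (if E x then 1 else 0)"
    using outcome_weight_relabel[of N V \<pi> "relabel N \<pi> x"] pos \<pi> relabel_relabel[of \<pi> N x] by simp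
qed (use relabel_relabel[of \<pi> N] \<pi> relabel_in_tournament_outcomes in auto)

section \<open>Likelihood ratios and the comparison of sole winners\<close>

text \<open>Change of measure from \<open>V\<close> to \<open>V'\<close>. Outcomes whose likelihood
  ratio is at most \<open>exp 1\<close> give the first term. The others are rare under
  \<open>V\<close>: the log-likelihood ratio is a sum of independent terms with squared ranges of
  total at most \<open>D\<close> and with mean at most \<open>D / 8\<close>.\<close>

lemma quenched_prob_likelihood_ratio:
  assumes pos: "\<And>k. k < N \<Longrightarrow> 0 < V k" and pos': "\<And>k. k < N \<Longrightarrow> 0 < V' k"
    and D: "(\<Sum>(a,b)\<in>matches N. ((ln (V a) - ln (V' a)) - (ln (V b) - ln (V' b)))\<^sup>2) \<le> D"
    and D01: "0 < D" "D \<le> 1"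
  shows "quenched_prob N V E \<le> exp 1 * quenched_prob N V' E + exp (- 1 / (2 * D))"
proof -
  let ?T = "tournament_outcomes N" and ?w = "outcome_weight N V" and ?w' = "outcome_weight N V'"
  \<comment> \<open>The log-likelihood ratio of a single match with result \<open>b\<close>.\<close>
  define a where "a = (\<lambda>i j b. ln (if b then V i / (V i + V j) else V j / (V i + V j))
                             - ln (if b then V' i / (V' i + V' j) else V' j / (V' i + V' j)))"
  have w0: "0 < ?w x" "0 < ?w' x" for x
    using pos pos' by (auto intro!: outcome_weight_pos)
  have mpos: "0 < V i" "0 < V j" "0 < V' i" "0 < V' j" if "(i, j) \<in> matches N" for i j
    using that pos pos' by (auto simp: matches_def)
  have ln_w: "ln (outcome_weight N W x) =
      (\<Sum>(i,j)\<in>matches N. ln (if x i j then W i / (W i + W j) else W j / (W i + W j)))"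
    if "\<And>k. k < N \<Longrightarrow> 0 < W k" for W x
  proof -
    have "(if x i j then W i / (W i + W j) else W j / (W i + W j)) \<noteq> 0" if "(i, j) \<in> matches N" for i j
      using \<open>\<And>k. k < N \<Longrightarrow> 0 < W k\<close>[of i] \<open>\<And>k. k < N \<Longrightarrow> 0 < W k\<close>[of j] that
      by (auto simp: matches_def)
    then show ?thesis
      unfolding outcome_weight_matches by (subst ln_prod) (auto intro!: sum.cong)
  qed
  \<comment> \<open>The normalising denominators are the same for both results and cancel.\<close>
  have range: "a i j True - a i j False = (ln (V i) - ln (V' i)) - (ln (V j) - ln (V' j))"
    if "(i, j) \<in> matches N" for i j
    using mpos[OF that] by (simp add: a_def ln_div)
  \<comment> \<open>The left-hand side is the relative entropy of a single match; Hoeffding's lemma applied to minus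
    its log-likelihood ratio, whose exponential has mean 1, bounds it.\<close>
  have kl: "V i / (V i + V j) * a i j True + V j / (V i + V j) * a i j False \<le>
     ((ln (V i) - ln (V' i)) - (ln (V j) - ln (V' j)))\<^sup>2 / 8" if "(i, j) \<in> matches N" for i j
  proof -
    note p = mpos[OF that]
    have "V i / (V i + V j) * exp (- a i j True) = V' i / (V' i + V' j)"
      using p by (simp add: a_def exp_diff)
    moreover have "V j / (V i + V j) * exp (- a i j False) = V' j / (V' i + V' j)"
      using p by (simp add: a_def exp_diff)
    moreover have "V' i / (V' i + V' j) + V' j / (V' i + V' j) = 1"
      using p by (simp add: add_divide_distrib[symmetric])
    ultimately have "1 = V i / (V i + V j) * exp (- a i j True) + V j / (V i + V j) * exp (- a i j False)"
      by simp
    also have "\<dots> \<le> exp (V i / (V i + V j) * (- a i j True) + V j / (V i + V j) * (- a i j False)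
       + (- a i j True - - a i j False)\<^sup>2 / 8)"
      by (rule bernoulli_mgf_le'[OF p(1,2)])
    finally have "0 \<le> V i / (V i + V j) * (- a i j True) + V j / (V i + V j) * (- a i j False)
       + (- a i j True - - a i j False)\<^sup>2 / 8"
      by simp
    also have "(- a i j True - - a i j False)\<^sup>2 = (a i j True - a i j False)\<^sup>2"
      by (simp add: power2_eq_square algebra_simps)
    finally show ?thesis unfolding range[OF that] by simp
  qed
  have "(\<Sum>(i,j)\<in>matches N. V i / (V i + V j) * a i j True + V j / (V i + V j) * a i j False) \<le>
    (\<Sum>(i,j)\<in>matches N. ((ln (V i) - ln (V' i)) - (ln (V j) - ln (V' j)))\<^sup>2 / 8)"
    using kl by (intro sum_mono) auto
  also have "\<dots> = (\<Sum>(i,j)\<in>matches N. ((ln (V i) - ln (V' i)) - (ln (V j) - ln (V' j)))\<^sup>2) / 8"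
    by (simp add: sum_divide_distrib case_prod_unfold)
  also have "\<dots> \<le> 1 / 2" using D D01 by simp
  finally have mean: "(\<Sum>(i,j)\<in>matches N. V i / (V i + V j) * a i j True +
      V j / (V i + V j) * a i j False) \<le> 1 / 2" .
  \<comment> \<open>The log-likelihood ratio would exceed 1 while its mean is at most 1 / 2: a
    deviation of 1 / 2.\<close>
  have tail: "quenched_prob N V (\<lambda>x. exp 1 * ?w' x < ?w x) \<le> exp (- 2 * (1 / 2)\<^sup>2 / D)"
  proof (rule quenched_prob_hoeffding[where a = a, OF pos])
    have "(\<Sum>(i,j)\<in>matches N. (a i j True - a i j False)\<^sup>2) =
       (\<Sum>(a,b)\<in>matches N. ((ln (V a) - ln (V' a)) - (ln (V b) - ln (V' b)))\<^sup>2)"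
      using range by (intro sum.cong) auto
    with D show "(\<Sum>(i,j)\<in>matches N. (a i j True - a i j False)\<^sup>2) \<le> D" by simp
  next
    fix x assume "exp 1 * ?w' x < ?w x"
    then have "ln (exp 1 * ?w' x) \<le> ln (?w x)"
      using w0[of x] by (intro ln_mono) auto
    then have "1 \<le> ln (?w x) - ln (?w' x)"
      using w0[of x] by (simp add: ln_mult)
    also have "\<dots> = (\<Sum>(i,j)\<in>matches N. a i j (x i j))"
      by (simp add: ln_w[OF pos] ln_w[OF pos'] a_def case_prod_unfold sum_subtractf)
    finally show "(\<Sum>(i,j)\<in>matches N. V i / (V i + V j) * a i j True +
      V j / (V i + V j) * a i j False) + 1 / 2 \<le> (\<Sum>(i,j)\<in>matches N. a i j (x i j))"
      using mean by linarith
  qed (use D01 in auto)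
  have "quenched_prob N V E \<le> (\<Sum>x\<in>?T. exp 1 * (?w' x * (if E x then 1 else 0)) +
       ?w x * (if exp 1 * ?w' x < ?w x then 1 else 0))"
    unfolding quenched_prob_def
  proof (rule sum_mono)
    fix x
    show "?w x * (if E x then 1 else 0) \<le> exp 1 * (?w' x * (if E x then 1 else 0)) +
       ?w x * (if exp 1 * ?w' x < ?w x then 1 else 0)"
      using w0[of x] by auto
  qed
  also have "\<dots> = exp 1 * quenched_prob N V' E + quenched_prob N V (\<lambda>x. exp 1 * ?w' x < ?w x)"
    by (simp only: quenched_prob_def sum.distrib sum_distrib_left)
  also have "\<dots> \<le> exp 1 * quenched_prob N V' E + exp (- 1 / (2 * D))"
    using tail by (simp add: power2_eq_square)
  finally show ?thesis .
qed

text \<open>Exchanging the strengths of \<open>i\<close> and \<open>j\<close> turns a sole victory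
  of \<open>i\<close> into one of \<open>j\<close>. The exchange alters only two log strengths, each
  by at most \<open>2 * d\<close>, so the likelihood ratio bound applies when
  \<open>N * d\<^sup>2\<close> is small.\<close>

lemma quenched_prob_sole_winner_compare:
  assumes pos: "\<And>k. k < N \<Longrightarrow> 0 < V k" and ij: "i < N" "j < N"
    and V: "1 - d \<le> V i" "V i \<le> 1" "1 - d \<le> V j" "V j \<le> 1"
    and d: "0 < d" "d \<le> 1 / 2" "16 * real N * d\<^sup>2 \<le> 1"
  shows "quenched_prob N V (\<lambda>x. is_sole_winner N x i) \<le>
    exp 1 * quenched_prob N V (\<lambda>x. is_sole_winner N x j) + exp (- 1 / (32 * real N * d\<^sup>2))"
proof -
  define \<pi> where "\<pi> = Transposition.transpose i j"
  have \<pi>: "inj \<pi>" "\<And>k. \<pi> (\<pi> k) = k" "\<And>k. k < N \<Longrightarrow> \<pi> k < N"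
    using ij by (auto simp: \<pi>_def Transposition.transpose_def)
  define u where "u = (\<lambda>a. ln (V a) - ln (V (\<pi> a)))"
  \<comment> \<open>This follows from \<open>ln (1 / v) \<le> 1 / v - 1\<close> and
    \<open>1 / (1 - d) \<le> 1 + 2 * d\<close>, the latter because
    \<open>d \<le> 1 / 2\<close>.\<close>
  have lnb: "- 2 * d \<le> ln v \<and> ln v \<le> 0" if "1 - d \<le> v" "v \<le> 1" for v :: real
  proof
    have v: "0 < v" using that d by linarith
    have "1 / v - 1 \<le> 2 * d"
    proof -
      have "1 / v \<le> 1 / (1 - d)" using that d by (intro divide_left_mono) auto
      also have "\<dots> \<le> 1 + 2 * d"
      proof -
        have "d * (2 * d) \<le> d * 1" using d by (intro mult_left_mono) auto
        then show ?thesis using d by (simp add: field_simps)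
      qed
      finally show ?thesis by simp
    qed
    moreover have "ln (1 / v) \<le> 1 / v - 1"
      using v by (intro ln_le_minus_one) simp
    ultimately show "- 2 * d \<le> ln v" using v by (simp add: ln_div)
    show "ln v \<le> 0" using v that by simp
  qed
  have u2: "(u a)\<^sup>2 \<le> 4 * d\<^sup>2 * (of_bool (a = i) + of_bool (a = j))" for a
  proof (cases "a = i \<or> a = j")
    case True
    then have "\<bar>u a\<bar> \<le> \<bar>2 * d\<bar>"
      using lnb[of "V i"] lnb[of "V j"] V by (auto simp: u_def \<pi>_def)
    then have "(u a)\<^sup>2 \<le> (2 * d)\<^sup>2"
      by (simp only: abs_le_square_iff)
    also have "\<dots> = 4 * d\<^sup>2 * 1" by (simp add: power2_eq_square)
    also have "\<dots> \<le> 4 * d\<^sup>2 * (of_bool (a = i) + of_bool (a = j))"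
      using True by (intro mult_left_mono) auto
    finally show ?thesis .
  qed (auto simp: u_def \<pi>_def)
  have incident: "(\<Sum>(a,b)\<in>matches N. of_bool (a = l) + of_bool (b = l)) \<le> real N" if "l < N" for l
  proof -
    have "(\<Sum>(a,b)\<in>matches N. of_bool (a = l) + (of_bool (b = l) :: real)) =
          (\<Sum>(a,b)\<in>matches N. if a = l then 1 else if b = l then 1 else 0)"
      by (intro sum.cong) (auto simp: matches_def)
    also have "\<dots> = (\<Sum>k\<in>{..<N} - {l}. 1)"
      by (rule sum_matches_incident[OF that])
    finally show ?thesis using that by simp
  qed
  \<comment> \<open>Two altered players, at most \<open>N\<close> matches each, and
    \<open>2 * (2 * d)\<^sup>2\<close> for each of these add up to
    \<open>16 * N * d\<^sup>2\<close>.\<close>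
  have "(\<Sum>(a,b)\<in>matches N. (u a - u b)\<^sup>2) \<le>
     (\<Sum>(a,b)\<in>matches N. 8 * d\<^sup>2 * (of_bool (a = i) + of_bool (b = i)) +
                         8 * d\<^sup>2 * (of_bool (a = j) + of_bool (b = j)))"
  proof (intro sum_mono, clarify)
    fix a b
    have "(u a - u b)\<^sup>2 \<le> 2 * (u a)\<^sup>2 + 2 * (u b)\<^sup>2"
      using zero_le_power2[of "u a + u b"] by (simp add: power2_eq_square algebra_simps)
    also have "\<dots> \<le> 2 * (4 * d\<^sup>2 * (of_bool (a = i) + of_bool (a = j))) +
                    2 * (4 * d\<^sup>2 * (of_bool (b = i) + of_bool (b = j)))"
      using u2[of a] u2[of b] by linarith
    finally show "(u a - u b)\<^sup>2 \<le> 8 * d\<^sup>2 * (of_bool (a = i) + of_bool (b = i)) +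
                         8 * d\<^sup>2 * (of_bool (a = j) + of_bool (b = j))"
      by (simp add: algebra_simps)
  qed
  also have "\<dots> = 8 * d\<^sup>2 * (\<Sum>(a,b)\<in>matches N. of_bool (a = i) + of_bool (b = i)) +
                  8 * d\<^sup>2 * (\<Sum>(a,b)\<in>matches N. of_bool (a = j) + of_bool (b = j))"
    by (simp only: case_prod_unfold sum.distrib[symmetric] sum_distrib_left)
  also have "\<dots> \<le> 8 * d\<^sup>2 * real N + 8 * d\<^sup>2 * real N"
    by (intro add_mono mult_left_mono incident ij) auto
  also have "\<dots> = 16 * real N * d\<^sup>2" by simp
  finally have D: "(\<Sum>(a,b)\<in>matches N.
      ((ln (V a) - ln ((V \<circ> \<pi>) a)) - (ln (V b) - ln ((V \<circ> \<pi>) b)))\<^sup>2) \<le> 16 * real N * d\<^sup>2"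
    by (simp add: u_def)
  have "quenched_prob N V (\<lambda>x. is_sole_winner N x i) \<le>
     exp 1 * quenched_prob N (V \<circ> \<pi>) (\<lambda>x. is_sole_winner N x i) + exp (- 1 / (2 * (16 * real N * d\<^sup>2)))"
    by (rule quenched_prob_likelihood_ratio[OF _ _ D]) (use pos \<pi> d ij in auto)
  also have "quenched_prob N (V \<circ> \<pi>) (\<lambda>x. is_sole_winner N x i) =
     quenched_prob N V (\<lambda>x. is_sole_winner N x (\<pi> i))"
    using quenched_prob_relabel[of N V \<pi> "\<lambda>x. is_sole_winner N x i"] pos \<pi>
      is_sole_winner_relabel[of \<pi> N i] ij by simp
  also have "\<pi> i = j" by (simp add: \<pi>_def)
  finally show ?thesis by (simp add: mult.assoc)
qed

section \<open>Quenched bounds on the position of the winners\<close>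

text \<open>Nearly equal players share the sole victories: each of them gets at most about
  \<open>exp 1 / card B\<close>. Passing from victories to sole victories costs the factor
  \<open>8 / c\<close>, unless the winner has too few defeats, which the last exponential covers. A
  union bound over \<open>A\<close> finishes. Here \<open>c\<close> bounds the mean strength from
  below.\<close>

lemma quenched_prob_winner_in_subset:
  assumes V: "\<And>k. k < N \<Longrightarrow> 0 < V k" "\<And>k. k < N \<Longrightarrow> V k \<le> 1"
    and B: "B \<subseteq> {..<N}" "A \<subseteq> B" "B \<noteq> {}" "\<And>i. i \<in> B \<Longrightarrow> 1 - d \<le> V i"
    and d: "0 < d" "d \<le> 1 / 2" "16 * real N * d\<^sup>2 \<le> 1"
    and c: "0 < c" "c * real N \<le> (\<Sum>k<N. V k)" "4 \<le> c * real N"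
  shows "quenched_prob N V (\<lambda>x. \<exists>i\<in>A. is_winner N x i) \<le>
     real (card A) * (8 / c * (exp 1 / real (card B) + exp (- 1 / (32 * real N * d\<^sup>2))) +
       exp (- c\<^sup>2 * real N / 32))"
proof -
  let ?W = "\<lambda>i. quenched_prob N V (\<lambda>x. is_winner N x i)"
  let ?S = "\<lambda>i. quenched_prob N V (\<lambda>x. is_sole_winner N x i)"
  let ?\<epsilon> = "exp (- 1 / (32 * real N * d\<^sup>2))"
  have finB: "finite B" using B(1) finite_subset by blast
  have finA: "finite A" using B(2) finB finite_subset by blast
  have cardB: "0 < real (card B)" using B(3) finB by (simp add: card_gt_0_iff)
  have N: "0 < real N" using c by (metis mult_eq_0_iff not_numeral_le_zero of_nat_0_less_iff of_nat_eq_0_iff gr0I)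
  have sole: "?S i \<le> exp 1 / real (card B) + ?\<epsilon>" if i: "i \<in> A" for i
  proof -
    \<comment> \<open>Average the comparison with \<open>j\<close> over all \<open>j\<close> in
      \<open>B\<close>; the disjoint sole victories have total probability at most 1.\<close>
    have "real (card B) * ?S i = (\<Sum>j\<in>B. ?S i)" by simp
    also have "\<dots> \<le> (\<Sum>j\<in>B. exp 1 * ?S j + ?\<epsilon>)"
    proof (rule sum_mono)
      fix j assume "j \<in> B"
      with i B V show "?S i \<le> exp 1 * ?S j + ?\<epsilon>"
        by (intro quenched_prob_sole_winner_compare d) auto
    qed
    also have "\<dots> = exp 1 * (\<Sum>j\<in>B. ?S j) + real (card B) * ?\<epsilon>"
      by (simp add: sum.distrib sum_distrib_left)
    also have "(\<Sum>j\<in>B. ?S j) \<le> 1"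
    proof (rule quenched_prob_disjoint[OF V(1) finB])
      fix x i j assume "i \<in> B" "j \<in> B" "is_sole_winner N x i" "is_sole_winner N x j"
      then show "i = j"
        using B(1) unfolding is_sole_winner_def by (metis lessThan_iff less_asym subsetD)
    qed
    finally show ?thesis using cardB by (simp add: field_simps)
  qed
  have winner: "?W i \<le> 8 / c * (exp 1 / real (card B) + ?\<epsilon>) + exp (- c\<^sup>2 * real N / 32)"
    if i: "i \<in> A" for i
  proof -
    have iN: "i < N" and Vi: "1 / 2 \<le> V i" using i B d by force+
    \<comment> \<open>The expected score is at most \<open>N - 1 / 2 - c * N / 2\<close>. Of this
      deficit \<open>?t\<close> and \<open>?L\<close> use \<open>3 * c * N / 8\<close>; the
      remaining \<open>c * N / 8\<close> is at least 1 / 2 by \<open>4 \<le> c * N\<close> and turns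
      \<open>N - 1 / 2\<close> into \<open>N - 1\<close>.\<close>
    let ?L = "c * real N / 4" and ?t = "c * real N / 8"
    have "?W i \<le> (\<Sum>b\<in>{True, False}. quenched_prob N V (\<lambda>x.
        if b then is_winner N x i \<and> real (score N x i) \<le> real N - 1 - ?L
             else expected_score N V i + ?t \<le> real (score N x i)))"
    proof (rule quenched_prob_union[OF V(1)])
      fix x assume "is_winner N x i"
      moreover have "expected_score N V i \<le> real N - 1 / 2 - (\<Sum>k<N. V k) / 2"
        by (rule expected_score_le[OF V iN])
      then have "expected_score N V i + ?t \<le> real N - 1 - ?L"
        using c by linarith
      ultimately show "\<exists>b\<in>{True, False}. if b then is_winner N x i \<and> real (score N x i) \<le> real N - 1 - ?L
             else expected_score N V i + ?t \<le> real (score N x i)"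
        by (cases "real (score N x i) \<le> real N - 1 - ?L") auto
    qed auto
    also have "\<dots> = quenched_prob N V (\<lambda>x. is_winner N x i \<and> real (score N x i) \<le> real N - 1 - ?L) +
                    quenched_prob N V (\<lambda>x. expected_score N V i + ?t \<le> real (score N x i))"
      by simp
    \<comment> \<open>The strength ratio is \<open>R = 2\<close>, since \<open>V k \<le> 1\<close>
      and \<open>V i \<ge> 1 / 2\<close>.\<close>
    also have "\<dots> \<le> real N * 2 / ?L * ?S i + exp (- 2 * ?t\<^sup>2 / real N)"
    proof (intro add_mono quenched_prob_winner_le_sole_winner score_tail V iN)
      fix k assume "k < N"
      with V(2)[of k] Vi show "V k \<le> 2 * V i" by linarith
    qed (use c N in auto)
    also have "real N * 2 / ?L = 8 / c" using N c by (simp add: field_simps)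
    also have "- 2 * ?t\<^sup>2 / real N = - c\<^sup>2 * real N / 32"
      using N by (simp add: power2_eq_square field_simps)
    also have "8 / c * ?S i \<le> 8 / c * (exp 1 / real (card B) + ?\<epsilon>)"
      using c sole[OF i] by (intro mult_left_mono) auto
    finally show ?thesis by simp
  qed
  have "quenched_prob N V (\<lambda>x. \<exists>i\<in>A. is_winner N x i) \<le> (\<Sum>i\<in>A. ?W i)"
    by (rule quenched_prob_union[OF V(1) finA]) auto
  also have "\<dots> \<le> (\<Sum>i\<in>A. 8 / c * (exp 1 / real (card B) + ?\<epsilon>) + exp (- c\<^sup>2 * real N / 32))"
    by (intro sum_mono winner)
  finally show ?thesis by simp
qed

text \<open>To win, \<open>i\<close> must at least reach the score of \<open>j\<close>, whose
  expected score is larger by \<open>c * d * N / 4\<close> or more; the union bound runs over at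
  most \<open>N\<close> players.\<close>

lemma quenched_prob_winner_outside:
  assumes V: "\<And>k. k < N \<Longrightarrow> 0 < V k" "\<And>k. k < N \<Longrightarrow> V k \<le> 1"
    and A: "A \<subseteq> {..<N}" "\<And>i. i \<in> A \<Longrightarrow> V i + d \<le> V j" and j: "j < N"
    and d: "0 \<le> d" and c: "0 \<le> c" "c * real N \<le> (\<Sum>k<N. V k)"
  shows "quenched_prob N V (\<lambda>x. \<exists>i\<in>A. is_winner N x i) \<le>
     real N * exp (- (c * d)\<^sup>2 * real N / 32)"
proof -
  have finA: "finite A" using A(1) finite_subset by blast
  have "quenched_prob N V (\<lambda>x. is_winner N x i) \<le> exp (- (c * d)\<^sup>2 * real N / 32)" if i: "i \<in> A" for i
  proof -
    have iN: "i < N" using i A by auto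
    have "d * (c * real N) \<le> d * (\<Sum>k<N. V k)"
      using c d by (intro mult_left_mono) auto
    then have "expected_score N V i + d * (c * real N) / 4 \<le> expected_score N V j"
      using expected_score_gap[OF V iN j d A(2)[OF i]] by simp
    then have "quenched_prob N V (\<lambda>x. score N x j \<le> score N x i) \<le>
        exp (- (d * (c * real N) / 4)\<^sup>2 / (2 * real N))"
      using c d by (intro score_upset_tail V iN j) auto
    also have "- (d * (c * real N) / 4)\<^sup>2 / (2 * real N) = - (c * d)\<^sup>2 * real N / 32"
      using iN by (simp add: power2_eq_square field_simps)
    finally show ?thesis
      using quenched_prob_mono[of N V "\<lambda>x. is_winner N x i" "\<lambda>x. score N x j \<le> score N x i"] V j
      by (auto simp: is_winner_def)
  qed
  then have "(\<Sum>i\<in>A. quenched_prob N V (\<lambda>x. is_winner N x i)) \<le>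
     real (card A) * exp (- (c * d)\<^sup>2 * real N / 32)"
    by (rule sum_bounded_above)
  also have "\<dots> \<le> real N * exp (- (c * d)\<^sup>2 * real N / 32)"
    using card_mono[OF _ A(1)] by (intro mult_right_mono) auto
  finally show ?thesis
    using quenched_prob_union[of N V A "\<lambda>x. \<exists>i\<in>A. is_winner N x i" "\<lambda>i x. is_winner N x i"] V finA
    by simp
qed

section \<open>Order statistics of the strengths\<close>

lemma order_stats_mono:
  assumes "i \<le> j" "j < N"
  shows "order_stats u N i \<le> order_stats u N j"
  using assms unfolding order_stats_def by (intro sorted_nth_mono) auto

lemma order_stats_in_range:
  assumes "i < N"
  shows "\<exists>k<N. order_stats u N i = u k"
proof -
  have "order_stats u N i \<in> set (sort (map u [0..<N]))"
    unfolding order_stats_def using assms by (intro nth_mem) simp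
  then show ?thesis by auto
qed

text \<open>Sorting preserves the multiset of values, so exceedances can be counted in the unsorted
  sample, where independence is available.\<close>

lemma card_order_stats_greater:
  "card {i. i < N \<and> c < order_stats u N i} = card {k. k < N \<and> c < u k}"
proof -
  let ?xs = "map u [0..<N]"
  have "card {i. i < N \<and> c < order_stats u N i} = length (filter (\<lambda>v. c < v) (sort ?xs))"
    by (simp add: length_filter_conv_card order_stats_def)
  also have "\<dots> = length (filter (\<lambda>v. c < v) ?xs)"
    by (metis mset_filter mset_sort size_mset)
  also have "\<dots> = card {k. k < N \<and> c < u k}"
    unfolding length_filter_conv_card by (rule arg_cong[where f = card]) auto
  finally show ?thesis .
qed

lemma card_top_players_le:
  assumes "0 \<le> r"
  shows "real (card (top_players N r)) \<le> r"
proof -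
  have "top_players N r \<subseteq> {nat \<lceil>real N - r\<rceil>..<N}"
    by (auto simp: top_players_def) linarith
  then have "card (top_players N r) \<le> N - nat \<lceil>real N - r\<rceil>"
    using card_mono[of "{nat \<lceil>real N - r\<rceil>..<N}"] by simp
  then have "real (card (top_players N r)) \<le> real (N - nat \<lceil>real N - r\<rceil>)"
    by simp
  also have "\<dots> \<le> r"
    using assms by linarith
  finally show ?thesis .
qed

text \<open>Values above \<open>c\<close> occupy the last positions. If position \<open>i\<close>
  were not among them, all exceedances would lie in the \<open>N - 1 - i < r\<close> positions after
  it.\<close>

lemma order_stats_top_player:
  assumes "i \<in> top_players N r" "r \<le> real (card {k. k < N \<and> c < u k})"
  shows "c < order_stats u N i"
proof (rule ccontr)
  assume *: "\<not> c < order_stats u N i"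
  have i: "i < N" "real N - r \<le> real i" using assms(1) by (auto simp: top_players_def ceiling_le_iff)
  have "{k. k < N \<and> c < order_stats u N k} \<subseteq> {Suc i..<N}"
  proof clarify
    fix k assume k: "k < N" "c < order_stats u N k"
    with * order_stats_mono[of k i N u] i show "k \<in> {Suc i..<N}"
      by (cases "k \<le> i") auto
  qed
  then have "card {k. k < N \<and> c < u k} \<le> N - Suc i"
    unfolding card_order_stats_greater[of N c u, symmetric]
    using card_mono[of "{Suc i..<N}" "{k. k < N \<and> c < order_stats u N k}"] by simp
  with i assms(2) show False by linarith
qed

text \<open>If the value at position \<open>i\<close> exceeded \<open>c\<close>, so would all
  \<open>N - i > r\<close> values from there on.\<close>

lemma order_stats_not_top_player:
  assumes "i < N" "i \<notin> top_players N r" "real (card {k. k < N \<and> c < u k}) \<le> r"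
  shows "order_stats u N i \<le> c"
proof (rule ccontr)
  assume *: "\<not> order_stats u N i \<le> c"
  have i: "real i < real N - r" using assms(1,2) by (auto simp: top_players_def not_le less_ceiling_iff)
  have "{i..<N} \<subseteq> {k. k < N \<and> c < order_stats u N k}"
  proof
    fix k assume "k \<in> {i..<N}"
    with * order_stats_mono[of i k N u] show "k \<in> {k. k < N \<and> c < order_stats u N k}" by auto
  qed
  then have "N - i \<le> card {k. k < N \<and> c < u k}"
    unfolding card_order_stats_greater[of N c u, symmetric]
    using card_mono[of "{k. k < N \<and> c < order_stats u N k}" "{i..<N}"] by simp
  with i assms show False by linarith
qed

section \<open>Concentration of the number of strengths above a threshold\<close>

context prob_space
begin

text \<open>The count is binomial with parameters \<open>N\<close> and \<open>q\<close>; its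
  exponential moment \<open>(1 + q * (exp s - 1)) ^ N\<close> is bounded by the Poisson one.\<close>

lemma expectation_exp_count:
  fixes U :: "nat \<Rightarrow> 'a \<Rightarrow> real" and s c :: real
  assumes indep: "indep_vars (\<lambda>_. borel) U UNIV"
    and ident: "\<And>k. distr M borel (U k) = distr M borel (U 0)"
    and q: "q = prob {\<omega> \<in> space M. c < U 0 \<omega>}"
  shows "integrable M (\<lambda>\<omega>. exp (s * real (card {k. k < N \<and> c < U k \<omega>})))"
    and "expectation (\<lambda>\<omega>. exp (s * real (card {k. k < N \<and> c < U k \<omega>}))) \<le> exp (real N * q * (exp s - 1))"
proof -
  \<comment> \<open>This is \<open>exp\<close> of \<open>s\<close> times the indicator of exceeding
    \<open>c\<close>, in affine form so that its mean is read off from \<open>q\<close>.\<close>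
  define g where "g = (\<lambda>v::real. 1 + (exp s - 1) * indicator {c<..} v :: real)"
  have [measurable]: "g \<in> borel_measurable borel" unfolding g_def by measurable
  have rv[measurable]: "U k \<in> borel_measurable M" for k
    using indep unfolding indep_vars_def by auto
  have prod: "exp (s * real (card {k. k < N \<and> c < U k \<omega>})) = (\<Prod>k<N. g (U k \<omega>))" for \<omega>
  proof -
    have "(\<Prod>k<N. g (U k \<omega>)) = (\<Prod>k<N. if c < U k \<omega> then exp s else 1)"
      by (intro prod.cong) (auto simp: g_def)
    also have "\<dots> = exp s ^ card {k. k < N \<and> c < U k \<omega>}"
      by (simp add: prod.If_cases Int_def)
    finally show ?thesis by (simp add: exp_of_nat_mult[symmetric] mult.commute)
  qed
  have gi: "integrable M (\<lambda>\<omega>. g (U k \<omega>))" for k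
    by (rule integrable_const_bound[of _ "1 + \<bar>exp s - 1\<bar>"]) (auto simp: g_def indicator_def)
  have ind: "indep_vars (\<lambda>_. borel) (\<lambda>k \<omega>. g (U k \<omega>)) {..<N}"
    by (rule indep_vars_compose2[where M' = "\<lambda>_. borel"]) (auto intro: indep_vars_subset[OF indep])
  show "integrable M (\<lambda>\<omega>. exp (s * real (card {k. k < N \<and> c < U k \<omega>})))"
    unfolding prod by (intro indep_vars_integrable ind gi) auto
  have mean: "expectation (\<lambda>\<omega>. g (U k \<omega>)) = 1 + (exp s - 1) * q" for k
  proof -
    have "expectation (\<lambda>\<omega>. g (U k \<omega>)) = integral\<^sup>L (distr M borel (U k)) g"
      by (rule integral_distr[symmetric]) auto
    also have "\<dots> = integral\<^sup>L (distr M borel (U 0)) g" by (simp only: ident[of k])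
    also have "\<dots> = expectation (\<lambda>\<omega>. g (U 0 \<omega>))"
      by (rule integral_distr) auto
    also have "\<dots> = expectation (\<lambda>\<omega>. 1 + (exp s - 1) * indicator {\<omega> \<in> space M. c < U 0 \<omega>} \<omega>)"
      by (intro Bochner_Integration.integral_cong) (auto simp: g_def indicator_def)
    also have "\<dots> = 1 + (exp s - 1) * q"
    proof -
      have "{\<omega> \<in> space M. c < U 0 \<omega>} \<in> events" by measurable
      then have "integrable M (indicator {\<omega> \<in> space M. c < U 0 \<omega>} :: _ \<Rightarrow> real)"
        by (intro integrable_real_indicator) (auto simp: emeasure_eq_measure)
      then show ?thesis by (simp add: q prob_space)
    qed
    finally show ?thesis .
  qed
  have q01: "0 \<le> q" "q \<le> 1" by (auto simp: q)
  have "expectation (\<lambda>\<omega>. exp (s * real (card {k. k < N \<and> c < U k \<omega>}))) =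
      (\<Prod>k<N. expectation (\<lambda>\<omega>. g (U k \<omega>)))"
    unfolding prod by (intro indep_vars_lebesgue_integral ind gi) auto
  also have "\<dots> = (1 + (exp s - 1) * q) ^ N" by (simp add: mean)
  also have "\<dots> \<le> exp ((exp s - 1) * q) ^ N"
  proof (rule power_mono)
    have "0 \<le> (1 - q) + exp s * q" using q01 by auto
    then show "0 \<le> 1 + (exp s - 1) * q" by (simp add: algebra_simps)
  qed (rule exp_ge_add_one_self)
  also have "\<dots> = exp (real N * q * (exp s - 1))"
    by (simp add: exp_of_nat_mult[symmetric] mult_ac)
  finally show "expectation (\<lambda>\<omega>. exp (s * real (card {k. k < N \<and> c < U k \<omega>}))) \<le> exp (real N * q * (exp s - 1))" .
qed

text \<open>Markov's inequality with a free sign of \<open>s\<close>: positive \<open>s\<close>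
  gives upper tails of the count, negative \<open>s\<close> lower tails.\<close>

lemma prob_count_tail:
  fixes U :: "nat \<Rightarrow> 'a \<Rightarrow> real" and s c :: real
  assumes indep: "indep_vars (\<lambda>_. borel) U UNIV"
    and ident: "\<And>k. distr M borel (U k) = distr M borel (U 0)"
    and q: "q = prob {\<omega> \<in> space M. c < U 0 \<omega>}"
  shows "{\<omega> \<in> space M. a \<le> s * real (card {k. k < N \<and> c < U k \<omega>})} \<in> events"
    and "prob {\<omega> \<in> space M. a \<le> s * real (card {k. k < N \<and> c < U k \<omega>})} \<le>
           exp (real N * q * (exp s - 1) - a)"
proof -
  let ?C = "\<lambda>\<omega>. s * real (card {k. k < N \<and> c < U k \<omega>})"
  define A where "A = {\<omega> \<in> space M. a \<le> ?C \<omega>}"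
  note E = expectation_exp_count[OF indep ident q, where s = s and N = N]
  \<comment> \<open>Measurability of the count is inherited from the integrability of its
    exponential.\<close>
  have "A = {\<omega> \<in> space M. exp a \<le> exp (?C \<omega>)}" by (simp add: A_def)
  also have "\<dots> \<in> events"
    using borel_measurable_integrable[OF E(1)] by measurable
  finally have ev: "A \<in> events" .
  have "prob A = expectation (indicator A)"
    using ev by simp
  also have "\<dots> \<le> expectation (\<lambda>\<omega>. exp (- a) * exp (?C \<omega>))"
  proof (rule integral_mono)
    show "integrable M (indicator A :: _ \<Rightarrow> real)"
      using ev by (intro integrable_real_indicator) (auto simp: emeasure_eq_measure)
    show "integrable M (\<lambda>\<omega>. exp (- a) * exp (?C \<omega>))"
      by (intro integrable_mult_right E(1))
    show "indicator A \<omega> \<le> exp (- a) * exp (?C \<omega>)" for \<omega>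
      unfolding A_def exp_add[symmetric] by (auto simp: indicator_def)
  qed
  also have "\<dots> = exp (- a) * expectation (\<lambda>\<omega>. exp (?C \<omega>))"
    by (rule integral_mult_right_zero)
  also have "\<dots> \<le> exp (- a) * exp (real N * q * (exp s - 1))"
    by (intro mult_left_mono E(2)) simp
  also have "\<dots> = exp (real N * q * (exp s - 1) - a)"
    by (simp add: exp_add[symmetric])
  finally have "prob A \<le> exp (real N * q * (exp s - 1) - a)" .
  with ev show "{\<omega> \<in> space M. a \<le> ?C \<omega>} \<in> events"
    and "prob {\<omega> \<in> space M. a \<le> ?C \<omega>} \<le> exp (real N * q * (exp s - 1) - a)"
    unfolding A_def .
qed

text \<open>Borel-Cantelli for the Chernoff bounds. The majorant \<open>b\<close> of the exponents
  lets summability be checked on an explicit sequence free of \<open>Q (c N)\<close>.\<close>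

lemma AE_count_tail:
  fixes U :: "nat \<Rightarrow> 'a \<Rightarrow> real" and s :: real and a c :: "nat \<Rightarrow> real"
  assumes indep: "indep_vars (\<lambda>_. borel) U UNIV"
    and ident: "\<And>k. distr M borel (U k) = distr M borel (U 0)"
    and Q: "\<And>x. Q x = prob {\<omega> \<in> space M. x < U 0 \<omega>}"
    and summable: "summable (\<lambda>N. exp (b N))"
    and b: "\<forall>\<^sub>F N in sequentially. real N * Q (c N) * (exp s - 1) - a N \<le> b N"
  shows "AE \<omega> in M. \<forall>\<^sub>F N in sequentially. s * real (card {k. k < N \<and> c N < U k \<omega>}) < a N"
proof -
  define A where "A = (\<lambda>N. {\<omega> \<in> space M. a N \<le> s * real (card {k. k < N \<and> c N < U k \<omega>})})"
  have A: "A N \<in> events" "prob (A N) \<le> exp (real N * Q (c N) * (exp s - 1) - a N)" for N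
    unfolding A_def by (rule prob_count_tail[OF indep ident Q])+
  have "summable (\<lambda>N. prob (A N))"
  proof (rule summable_comparison_test_ev[OF _ summable])
    show "\<forall>\<^sub>F N in sequentially. norm (prob (A N)) \<le> exp (b N)"
      using b
    proof eventually_elim
      case (elim N)
      then have "exp (real N * Q (c N) * (exp s - 1) - a N) \<le> exp (b N)" by simp
      with A(2)[of N] show ?case by (simp only: real_norm_def abs_of_nonneg[OF measure_nonneg])
    qed
  qed
  then have "AE \<omega> in M. \<forall>\<^sub>F N in sequentially. \<omega> \<in> space M - A N"
    by (intro borel_cantelli_AE1 A) (auto simp: emeasure_eq_measure)
  then show ?thesis
    by eventually_elim (auto simp: A_def not_le elim!: eventually_mono)
qed

end

text \<open>The larger power of \<open>N\<close> dominates both the smaller one and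
  \<open>2 * ln N\<close>, so the terms are eventually below \<open>1 / N\<^sup>2\<close>.\<close>

lemma summable_exp_powr_diff:
  fixes A B \<kappa> \<gamma> :: real
  assumes "0 < A" "0 < \<gamma>" "\<kappa> < \<gamma>"
  shows "summable (\<lambda>N. exp (B * real N powr \<kappa> - A * real N powr \<gamma>))"
proof -
  have "(\<lambda>N. B * real N powr (\<kappa> - \<gamma>) + 2 * (ln (real N) / real N powr \<gamma>)) \<longlonglongrightarrow> B * 0 + 2 * 0"
  proof (intro tendsto_intros)
    show "(\<lambda>N. real N powr (\<kappa> - \<gamma>)) \<longlonglongrightarrow> 0"
      using assms by (intro tendsto_neg_powr filterlim_real_sequentially) auto
    show "(\<lambda>N. ln (real N) / real N powr \<gamma>) \<longlonglongrightarrow> 0"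
      using assms by real_asymp
  qed
  then have "\<forall>\<^sub>F N in sequentially. B * real N powr (\<kappa> - \<gamma>) + 2 * (ln (real N) / real N powr \<gamma>) < A"
    by (rule order_tendstoD) (use assms in auto)
  then have "\<forall>\<^sub>F N in sequentially. norm (exp (B * real N powr \<kappa> - A * real N powr \<gamma>)) \<le> 1 / real N ^ 2"
    using eventually_gt_at_top[of 0]
  proof eventually_elim
    case (elim N)
    have "(B * real N powr (\<kappa> - \<gamma>) + 2 * (ln (real N) / real N powr \<gamma>)) * real N powr \<gamma> \<le> A * real N powr \<gamma>"
      using elim by (intro mult_right_mono) auto
    then have "B * real N powr \<kappa> - A * real N powr \<gamma> \<le> - 2 * ln (real N)"
      using elim by (simp add: powr_diff field_simps)
    then have "exp (B * real N powr \<kappa> - A * real N powr \<gamma>) \<le> exp (- 2 * ln (real N))"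
      by simp
    also have "\<dots> = 1 / real N ^ 2"
      using elim by (simp add: exp_minus exp_double inverse_eq_divide)
    finally show ?case by simp
  qed
  moreover have "summable (\<lambda>N. 1 / real N ^ 2)"
    using inverse_power_summable[of 2, where ?'a = real] by (simp add: inverse_eq_divide)
  ultimately show ?thesis by (rule summable_comparison_test_ev)
qed

text \<open>For \<open>s = -1\<close> this makes the Chernoff exponent of a lower tail at most minus
  half the mean count, plus the threshold.\<close>

lemma exp_minus_one_le_half: "exp (- 1) - 1 \<le> - (1 / 2 :: real)"
proof -
  have "(2::real) \<le> exp 1" using exp_ge_add_one_self[of 1] by simp
  then show ?thesis by (simp add: exp_minus field_simps)
qed

section \<open>Almost sure numbers of players near the maximal strength\<close>

context prob_space
begin

context
  fixes U :: "nat \<Rightarrow> 'a \<Rightarrow> real" and \<alpha> :: real and Q :: "real \<Rightarrow> real"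
  assumes indep: "indep_vars (\<lambda>_. borel) U UNIV"
    and ident: "\<And>k. distr M borel (U k) = distr M borel (U 0)"
    and Q: "\<And>x. Q x = prob {\<omega> \<in> space M. x < U 0 \<omega>}"
    and Q_pos: "\<And>x. x < 1 \<Longrightarrow> 0 < Q x"
    and reg: "(\<lambda>u. ln (Q (1 - u)) - \<alpha> * ln u) \<in> o[at_right 0](\<lambda>u. ln u)"
begin

text \<open>The regularity assumption at \<open>u = N powr (- \<beta>)\<close>: an error of
  \<open>\<eta>\<close> times \<open>\<bar>ln u\<bar>\<close> in the logarithm is an error of
  \<open>\<beta> * \<eta>\<close> in the exponent of \<open>N\<close>.\<close>

lemma tail_powr_bounds:
  assumes "0 < \<beta>" "0 < \<eta>"
  shows "\<forall>\<^sub>F N in sequentially. real N powr (- \<beta> * (\<alpha> + \<eta>)) \<le> Q (1 - real N powr (- \<beta>)) \<and>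
           Q (1 - real N powr (- \<beta>)) \<le> real N powr (- \<beta> * (\<alpha> - \<eta>))"
proof -
  have "\<forall>\<^sub>F u in at_right 0. norm (ln (Q (1 - u)) - \<alpha> * ln u) \<le> \<eta> * norm (ln u)"
    using reg \<open>0 < \<eta>\<close> by (rule landau_o.smallD)
  moreover have "filterlim (\<lambda>N. real N powr (- \<beta>)) (at_right 0) sequentially"
    using \<open>0 < \<beta>\<close> by real_asymp
  ultimately have "\<forall>\<^sub>F N in sequentially.
      norm (ln (Q (1 - real N powr (- \<beta>))) - \<alpha> * ln (real N powr (- \<beta>))) \<le> \<eta> * norm (ln (real N powr (- \<beta>)))"
    by (rule eventually_compose_filterlim)
  then show ?thesis using eventually_gt_at_top[of 0]
  proof eventually_elim
    case (elim N)
    let ?q = "Q (1 - real N powr (- \<beta>))"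
    \<comment> \<open>Positivity of the tail is what allows \<open>exp\<close> to undo
      \<open>ln\<close> below.\<close>
    have q: "0 < ?q" using elim by (intro Q_pos) auto
    have l: "0 \<le> ln (real N)" using elim by simp
    have "\<bar>ln ?q + \<alpha> * (\<beta> * ln (real N))\<bar> \<le> \<eta> * (\<beta> * ln (real N))"
      using elim(1) l \<open>0 < \<beta>\<close> elim(2) by (simp add: ln_powr abs_mult)
    then have "- \<beta> * (\<alpha> + \<eta>) * ln (real N) \<le> ln ?q \<and> ln ?q \<le> - \<beta> * (\<alpha> - \<eta>) * ln (real N)"
      by (simp add: abs_le_iff algebra_simps)
    then have "exp (- \<beta> * (\<alpha> + \<eta>) * ln (real N)) \<le> exp (ln ?q) \<and>
               exp (ln ?q) \<le> exp (- \<beta> * (\<alpha> - \<eta>) * ln (real N))"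
      by (simp only: exp_le_cancel_iff)
    then have "exp (- \<beta> * (\<alpha> + \<eta>) * ln (real N)) \<le> ?q \<and> ?q \<le> exp (- \<beta> * (\<alpha> - \<eta>) * ln (real N))"
      by (simp only: exp_ln[OF q])
    then show ?case using elim(2) by (simp add: powr_def)
  qed
qed

text \<open>The mean count is \<open>N * Q x\<close>. Asking for a quarter of it with
  \<open>s = -1\<close> leaves the exponent \<open>- N * Q x / 4\<close>, summable as a geometric
  series.\<close>

lemma AE_many_above:
  assumes "x < 1"
  shows "AE \<omega> in M. \<forall>\<^sub>F N in sequentially.
    Q x / 4 * real N \<le> real (card {k. k < N \<and> x < U k \<omega>})"
proof -
  have "AE \<omega> in M. \<forall>\<^sub>F N in sequentially.
     (- 1) * real (card {k. k < N \<and> x < U k \<omega>}) < - (Q x / 4 * real N)"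
  proof (rule AE_count_tail[OF indep ident Q])
    have "summable (\<lambda>N. exp (- Q x / 4) ^ N)"
      using Q_pos[OF assms] by (intro summable_geometric) simp
    then show "summable (\<lambda>N. exp (- Q x / 4 * real N))"
      by (simp add: exp_of_nat_mult[symmetric] mult.commute)
    show "\<forall>\<^sub>F N in sequentially. real N * Q x * (exp (- 1) - 1) - - (Q x / 4 * real N) \<le> - Q x / 4 * real N"
    proof (intro always_eventually allI)
      fix N
      have "real N * Q x * (exp (- 1) - 1) \<le> real N * Q x * (- (1 / 2))"
        using Q_pos[OF assms] by (intro mult_left_mono exp_minus_one_le_half) auto
      then show "real N * Q x * (exp (- 1) - 1) - - (Q x / 4 * real N) \<le> - Q x / 4 * real N"
        by (simp add: field_simps)
    qed
  qed
  then show ?thesis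
    by eventually_elim (auto elim!: eventually_mono)
qed

text \<open>The mean count has exponent \<open>1 - \<alpha> * \<beta>\<close> up to arbitrarily
  small errors, and the lower tail at a smaller power \<open>N powr \<gamma>\<close> is
  summable.\<close>

lemma AE_count_near_top_ge:
  assumes "0 < \<beta>" "0 \<le> \<gamma>" "\<gamma> < 1 - \<alpha> * \<beta>"
  shows "AE \<omega> in M. \<forall>\<^sub>F N in sequentially.
    real N powr \<gamma> \<le> real (card {k. k < N \<and> 1 - real N powr (- \<beta>) < U k \<omega>})"
proof -
  \<comment> \<open>Chosen so that \<open>\<kappa>\<close> is the midpoint of
    \<open>\<gamma>\<close> and \<open>1 - \<alpha> * \<beta>\<close>; eventually the mean count is
    at least \<open>N powr \<kappa>\<close>.\<close>
  define \<eta> where "\<eta> = (1 - \<alpha> * \<beta> - \<gamma>) / (2 * \<beta>)"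
  define \<kappa> where "\<kappa> = 1 - \<beta> * (\<alpha> + \<eta>)"
  have \<eta>: "0 < \<eta>" using assms by (simp add: \<eta>_def)
  have "\<beta> * \<eta> = (1 - \<alpha> * \<beta> - \<gamma>) / 2"
    using assms by (simp add: \<eta>_def)
  then have \<kappa>: "\<gamma> < \<kappa>"
    using assms(3) by (simp add: \<kappa>_def distrib_left mult.commute[of \<beta> \<alpha>])
  have "AE \<omega> in M. \<forall>\<^sub>F N in sequentially.
     (- 1) * real (card {k. k < N \<and> 1 - real N powr (- \<beta>) < U k \<omega>}) < - (real N powr \<gamma>)"
  proof (rule AE_count_tail[OF indep ident Q])
    show "summable (\<lambda>N. exp (1 * real N powr \<gamma> - 1 / 2 * real N powr \<kappa>))"
      using \<kappa> assms by (intro summable_exp_powr_diff) auto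
    show "\<forall>\<^sub>F N in sequentially. real N * Q (1 - real N powr (- \<beta>)) * (exp (- 1) - 1) - - (real N powr \<gamma>)
        \<le> 1 * real N powr \<gamma> - 1 / 2 * real N powr \<kappa>"
      using tail_powr_bounds[OF assms(1) \<eta>] eventually_gt_at_top[of 0]
    proof eventually_elim
      case (elim N)
      have "real N powr \<kappa> = real N powr (1 + - \<beta> * (\<alpha> + \<eta>))" by (simp add: \<kappa>_def)
      also have "\<dots> = real N * real N powr (- \<beta> * (\<alpha> + \<eta>))"
        unfolding powr_add using elim(2) by simp
      also have "\<dots> \<le> real N * Q (1 - real N powr (- \<beta>))"
        using elim by (intro mult_left_mono) auto
      finally have 1: "real N powr \<kappa> \<le> real N * Q (1 - real N powr (- \<beta>))" .
      have "real N * Q (1 - real N powr (- \<beta>)) * (exp (- 1) - 1) \<le>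
            real N * Q (1 - real N powr (- \<beta>)) * (- (1 / 2))"
        by (intro mult_left_mono exp_minus_one_le_half) (simp add: Q)
      with 1 show ?case by simp
    qed
  qed
  then show ?thesis
    by eventually_elim (auto elim!: eventually_mono)
qed

lemma AE_count_near_top_le:
  assumes "0 < \<beta>" "0 < \<gamma>" "1 - \<alpha> * \<beta> < \<gamma>"
  shows "AE \<omega> in M. \<forall>\<^sub>F N in sequentially.
    real (card {k. k < N \<and> 1 - real N powr (- \<beta>) < U k \<omega>}) \<le> real N powr \<gamma>"
proof -
  \<comment> \<open>Again \<open>\<kappa>\<close> is the midpoint of
    \<open>1 - \<alpha> * \<beta>\<close> and \<open>\<gamma>\<close>, now eventually an upper
    exponent for the mean count.\<close>
  define \<eta> where "\<eta> = (\<gamma> - (1 - \<alpha> * \<beta>)) / (2 * \<beta>)"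
  define \<kappa> where "\<kappa> = 1 - \<beta> * (\<alpha> - \<eta>)"
  have \<eta>: "0 < \<eta>" using assms by (simp add: \<eta>_def)
  have "\<beta> * \<eta> = (\<gamma> - (1 - \<alpha> * \<beta>)) / 2"
    using assms by (simp add: \<eta>_def)
  then have \<kappa>: "\<kappa> < \<gamma>"
    using assms(3) by (simp add: \<kappa>_def right_diff_distrib mult.commute[of \<beta> \<alpha>])
  have "AE \<omega> in M. \<forall>\<^sub>F N in sequentially.
     1 * real (card {k. k < N \<and> 1 - real N powr (- \<beta>) < U k \<omega>}) < real N powr \<gamma>"
  proof (rule AE_count_tail[OF indep ident Q])
    show "summable (\<lambda>N. exp ((exp 1 - 1) * real N powr \<kappa> - 1 * real N powr \<gamma>))"
      using \<kappa> assms by (intro summable_exp_powr_diff) auto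
    show "\<forall>\<^sub>F N in sequentially. real N * Q (1 - real N powr (- \<beta>)) * (exp 1 - 1) - real N powr \<gamma>
        \<le> (exp 1 - 1) * real N powr \<kappa> - 1 * real N powr \<gamma>"
      using tail_powr_bounds[OF assms(1) \<eta>] eventually_gt_at_top[of 0]
    proof eventually_elim
      case (elim N)
      have "real N * Q (1 - real N powr (- \<beta>)) \<le> real N * real N powr (- \<beta> * (\<alpha> - \<eta>))"
        using elim by (intro mult_left_mono) auto
      also have "\<dots> = real N powr (1 + - \<beta> * (\<alpha> - \<eta>))"
        unfolding powr_add using elim(2) by simp
      also have "\<dots> = real N powr \<kappa>" by (simp add: \<kappa>_def)
      finally have "real N * Q (1 - real N powr (- \<beta>)) * (exp 1 - 1) \<le> real N powr \<kappa> * (exp 1 - 1)"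
        by (intro mult_right_mono) auto
      then show ?case by (simp add: mult.commute)
    qed
  qed
  then show ?thesis
    by eventually_elim (auto elim!: eventually_mono)
qed

end

end

section \<open>The almost sure limits\<close>

lemma order_stats_bounds:
  assumes "\<And>k. 0 < u k" "\<And>k. u k \<le> 1" "i < N"
  shows "0 < order_stats u N i" "order_stats u N i \<le> 1"
  using order_stats_in_range[OF assms(3), of u] assms(1,2) by auto

text \<open>Keeping only the strengths above 1 / 2 shows that the total strength is linear in
  \<open>N\<close> as soon as they form a positive fraction.\<close>

lemma sum_order_stats_ge:
  assumes u: "\<And>k. 0 < u k" "\<And>k. u k \<le> 1"
  shows "real (card {k. k < N \<and> 1 / 2 < u k}) / 2 \<le> (\<Sum>k<N. order_stats u N k)"
proof -
  let ?B = "{k. k < N \<and> 1 / 2 < order_stats u N k}"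
  have "real (card {k. k < N \<and> 1 / 2 < u k}) / 2 = (\<Sum>k\<in>?B. 1 / 2)"
    unfolding card_order_stats_greater[of N "1 / 2" u, symmetric] by simp
  also have "\<dots> \<le> (\<Sum>k\<in>?B. order_stats u N k)"
    by (intro sum_mono) auto
  also have "\<dots> \<le> (\<Sum>k<N. order_stats u N k)"
    using order_stats_bounds(1)[of u _ N, OF u] by (intro sum_mono2) (auto intro: less_imp_le)
  finally show ?thesis .
qed

text \<open>The complement of the event is that \<open>A N\<close> contains a winner, so a vanishing
  bound on that probability suffices for both halves of the result.\<close>

lemma quenched_prob_no_winner_in_tendsto:
  assumes u: "\<And>k. 0 < u k" "\<And>k. u k \<le> 1"
    and b: "\<forall>\<^sub>F N in sequentially.
       quenched_prob N (order_stats u N) (\<lambda>x. \<exists>i\<in>A N. is_winner N x i) \<le> b N" "b \<longlonglongrightarrow> 0"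
  shows "(\<lambda>N. quenched_prob N (order_stats u N) (\<lambda>x. \<forall>i\<in>A N. \<exists>j<N. score N x i < score N x j))
           \<longlonglongrightarrow> 1"
proof (rule tendsto_sandwich)
  show "\<forall>\<^sub>F N in sequentially. 1 - b N \<le>
     quenched_prob N (order_stats u N) (\<lambda>x. \<forall>i\<in>A N. \<exists>j<N. score N x i < score N x j)"
    using b(1)
  proof eventually_elim
    case (elim N)
    have "(\<forall>i\<in>A N. \<exists>j<N. score N x i < score N x j) \<longleftrightarrow> \<not> (\<exists>i\<in>A N. is_winner N x i)" for x
      by (auto simp: is_winner_def not_le)
    with elim show ?case
      using quenched_prob_not[of N "order_stats u N" "\<lambda>x. \<exists>i\<in>A N. is_winner N x i"]
        order_stats_bounds(1)[of u _ N, OF u] by simp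
  qed
  show "\<forall>\<^sub>F N in sequentially. quenched_prob N (order_stats u N)
      (\<lambda>x. \<forall>i\<in>A N. \<exists>j<N. score N x i < score N x j) \<le> 1"
    using order_stats_bounds(1)[of u, OF u] by (intro always_eventually allI quenched_prob_le_1) auto
  show "(\<lambda>N. 1 - b N) \<longlonglongrightarrow> 1"
    using tendsto_diff[OF tendsto_const[of 1] b(2)] by simp
qed auto

text \<open>The top \<open>N powr \<gamma>\<close> players lie among the at least
  \<open>N powr \<gamma>'\<close> players within \<open>d N\<close> of 1, and
  \<open>N * (d N)\<^sup>2 = N powr (- 2 * \<epsilon>)\<close> tends to 0, so all of these are
  comparable.\<close>

lemma top_players_lose:
  assumes u: "\<And>k. 0 < u k" "\<And>k. u k \<le> 1" and c: "0 < c"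
    and half: "\<forall>\<^sub>F N in sequentially. 2 * c * real N \<le> real (card {k. k < N \<and> 1 / 2 < u k})"
    and near: "\<forall>\<^sub>F N in sequentially.
       real N powr \<gamma>' \<le> real (card {k. k < N \<and> 1 - real N powr (- (1 / 2 + \<epsilon>)) < u k})"
    and \<epsilon>: "0 < \<epsilon>" and \<gamma>: "\<gamma> < \<gamma>'"
  shows "(\<lambda>N. quenched_prob N (order_stats u N)
    (\<lambda>x. \<forall>i\<in>top_players N (real N powr \<gamma>). \<exists>j<N. score N x i < score N x j)) \<longlonglongrightarrow> 1"
proof (rule quenched_prob_no_winner_in_tendsto[OF u])
  define d where "d = (\<lambda>N::nat. real N powr (- (1 / 2 + \<epsilon>)))"
  define b where "b = (\<lambda>N::nat. real N powr \<gamma> * (8 / c * (exp 1 / real N powr \<gamma>' +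
     exp (- (real N powr (2 * \<epsilon>)) / 32)) + exp (- c\<^sup>2 * real N / 32)))"
  have d2: "real N * (d N)\<^sup>2 = real N powr (- (2 * \<epsilon>))" if "0 < N" for N
  proof -
    have "(d N)\<^sup>2 = real N powr (- 1 + - (2 * \<epsilon>))"
      unfolding d_def power2_eq_square powr_add[symmetric]
      by (rule arg_cong[where f = "\<lambda>e. real N powr e"]) (simp add: algebra_simps)
    also have "\<dots> = real N powr (- (2 * \<epsilon>)) / real N"
      unfolding powr_add using that by (simp add: powr_minus field_simps)
    finally show ?thesis using that by simp
  qed
  have "\<forall>\<^sub>F N in sequentially. d N \<le> 1 / 2" unfolding d_def using \<epsilon> by real_asymp
  moreover have "\<forall>\<^sub>F N in sequentially. 16 * real N powr (- (2 * \<epsilon>)) \<le> 1" using \<epsilon> by real_asymp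
  moreover have "\<forall>\<^sub>F N in sequentially. 4 \<le> c * real N" using c by real_asymp
  ultimately show "\<forall>\<^sub>F N in sequentially. quenched_prob N (order_stats u N)
      (\<lambda>x. \<exists>i\<in>top_players N (real N powr \<gamma>). is_winner N x i) \<le> b N"
    using half near eventually_gt_at_top[of 0]
  proof eventually_elim
    case (elim N)
    let ?V = "order_stats u N" and ?A = "top_players N (real N powr \<gamma>)"
    let ?B = "{i. i < N \<and> 1 - d N < ?V i}"
    have d0: "0 < d N" using elim by (simp add: d_def)
    have near: "real N powr \<gamma>' \<le> real (card {k. k < N \<and> 1 - d N < u k})"
      using elim by (simp add: d_def)
    then have B: "real N powr \<gamma>' \<le> real (card ?B)"
      by (simp add: card_order_stats_greater)
    have g0: "0 < real N powr \<gamma>'" using elim by simp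
    have "real N powr \<gamma> \<le> real N powr \<gamma>'"
      using \<gamma> elim by (intro powr_mono) auto
    with near have AB: "?A \<subseteq> ?B"
      by (auto intro!: order_stats_top_player[where r = "real N powr \<gamma>"] simp: top_players_def)
    have "quenched_prob N ?V (\<lambda>x. \<exists>i\<in>?A. is_winner N x i) \<le>
      real (card ?A) * (8 / c * (exp 1 / real (card ?B) + exp (- 1 / (32 * real N * (d N)\<^sup>2))) +
       exp (- c\<^sup>2 * real N / 32))"
    proof (rule quenched_prob_winner_in_subset)
      show "?B \<noteq> {}"
        using B g0 by (metis card.empty not_le of_nat_0)
      show "16 * real N * (d N)\<^sup>2 \<le> 1"
        using elim d2[of N] by (simp add: mult.assoc)
      show "c * real N \<le> (\<Sum>k<N. ?V k)"
        using elim sum_order_stats_ge[of u N, OF u] by simp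
    qed (use order_stats_bounds[of u _ N, OF u] AB d0 c elim in auto)
    also have "exp (- 1 / (32 * real N * (d N)\<^sup>2)) = exp (- (real N powr (2 * \<epsilon>)) / 32)"
      unfolding mult.assoc d2[OF elim(6)] powr_minus inverse_eq_divide by simp
    also have "real (card ?A) * (8 / c * (exp 1 / real (card ?B) + exp (- (real N powr (2 * \<epsilon>)) / 32)) +
       exp (- c\<^sup>2 * real N / 32)) \<le> b N"
      unfolding b_def
    proof (intro mult_mono add_mono mult_left_mono card_top_players_le order_refl)
      show "exp 1 / real (card ?B) \<le> exp 1 / real N powr \<gamma>'"
        by (rule divide_left_mono[OF B _ mult_pos_pos[OF less_le_trans[OF g0 B] g0]]) simp
    qed (use c in auto)
    finally show ?case .
  qed
  \<comment> \<open>The three terms are the ratio of the group sizes, the error of the change of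
    measure, and the risk of a score so high that too few defeats remain.\<close>
  have "(\<lambda>N. 8 * exp 1 / c * real N powr (\<gamma> - \<gamma>') +
     8 / c * (real N powr \<gamma> * exp (- (real N powr (2 * \<epsilon>)) / 32)) +
     real N powr \<gamma> * exp (- c\<^sup>2 * real N / 32)) \<longlonglongrightarrow> 8 * exp 1 / c * 0 + 8 / c * 0 + 0"
  proof (intro tendsto_intros)
    show "(\<lambda>N. real N powr (\<gamma> - \<gamma>')) \<longlonglongrightarrow> 0"
      using \<gamma> by (intro tendsto_neg_powr filterlim_real_sequentially) auto
    show "(\<lambda>N. real N powr \<gamma> * exp (- (real N powr (2 * \<epsilon>)) / 32)) \<longlonglongrightarrow> 0"
      using \<epsilon> by real_asymp
    have "0 < c\<^sup>2 / 32" using c by simp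
    then have "(\<lambda>N. real N powr \<gamma> * exp (- (c\<^sup>2 / 32) * real N)) \<longlonglongrightarrow> 0"
      by real_asymp
    then show "(\<lambda>N. real N powr \<gamma> * exp (- c\<^sup>2 * real N / 32)) \<longlonglongrightarrow> 0"
      by simp
  qed
  then show "b \<longlonglongrightarrow> 0"
    by (simp add: b_def powr_diff algebra_simps)
qed

text \<open>Outsiders are at least \<open>2 * d N\<close> below 1 and the best player at most
  \<open>N powr (- 1 / 2)\<close>, eventually no more than \<open>d N\<close>; the gap
  \<open>d N\<close> makes the union bound decay like
  \<open>exp (- c\<^sup>2 * N powr (2 * \<epsilon>) / 128)\<close> up to a factor
  \<open>N\<close>.\<close>

lemma top_players_win:
  assumes u: "\<And>k. 0 < u k" "\<And>k. u k \<le> 1" and c: "0 < c"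
    and half: "\<forall>\<^sub>F N in sequentially. 2 * c * real N \<le> real (card {k. k < N \<and> 1 / 2 < u k})"
    and best: "\<forall>\<^sub>F N in sequentially.
       1 \<le> real (card {k. k < N \<and> 1 - real N powr (- (1 / 2)) < u k})"
    and few: "\<forall>\<^sub>F N in sequentially.
       real (card {k. k < N \<and> 1 - real N powr (- (1 / 2 - \<epsilon>)) < u k}) \<le> real N powr \<gamma>"
    and \<epsilon>: "0 < \<epsilon>"
  shows "(\<lambda>N. quenched_prob N (order_stats u N)
    (\<lambda>x. \<forall>i\<in>{i. i < N \<and> i \<notin> top_players N (real N powr \<gamma>)}. \<exists>j<N. score N x i < score N x j))
      \<longlonglongrightarrow> 1"
proof (rule quenched_prob_no_winner_in_tendsto[OF u])
  define d where "d = (\<lambda>N::nat. real N powr (- (1 / 2 - \<epsilon>)) / 2)"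
  define b where "b = (\<lambda>N::nat. real N * exp (- (c\<^sup>2 / 128) * real N powr (2 * \<epsilon>)))"
  have d2: "(c * d N)\<^sup>2 * real N = c\<^sup>2 / 4 * real N powr (2 * \<epsilon>)" if "0 < N" for N
  proof -
    have "(2 * d N)\<^sup>2 = real N powr (- 1 + 2 * \<epsilon>)"
      unfolding d_def power2_eq_square by (simp add: powr_add[symmetric] algebra_simps)
    also have "\<dots> = real N powr (2 * \<epsilon>) / real N"
      unfolding powr_add using that by (simp add: powr_minus field_simps)
    finally have "(2 * d N)\<^sup>2 * real N = real N powr (2 * \<epsilon>)" using that by simp
    then show ?thesis by (simp add: power_mult_distrib)
  qed
  have "\<forall>\<^sub>F N in sequentially. real N powr (- (1 / 2)) \<le> d N" unfolding d_def using \<epsilon> by real_asymp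
  then show "\<forall>\<^sub>F N in sequentially. quenched_prob N (order_stats u N)
      (\<lambda>x. \<exists>i\<in>{i. i < N \<and> i \<notin> top_players N (real N powr \<gamma>)}. is_winner N x i) \<le> b N"
    using half best few eventually_gt_at_top[of 0]
  proof eventually_elim
    case (elim N)
    let ?V = "order_stats u N"
    let ?A = "{i. i < N \<and> i \<notin> top_players N (real N powr \<gamma>)}"
    \<comment> \<open>Player \<open>N - 1\<close> is the only member of
      \<open>top_players N 1\<close>.\<close>
    have best: "1 - real N powr (- (1 / 2)) < ?V (N - 1)"
      by (rule order_stats_top_player[where r = 1]) (use elim in \<open>auto simp: top_players_def of_nat_diff\<close>)
    have "quenched_prob N ?V (\<lambda>x. \<exists>i\<in>?A. is_winner N x i) \<le>
       real N * exp (- (c * d N)\<^sup>2 * real N / 32)"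
    proof (rule quenched_prob_winner_outside)
      fix i assume "i \<in> ?A"
      then have "?V i \<le> 1 - real N powr (- (1 / 2 - \<epsilon>))"
        using elim by (intro order_stats_not_top_player[where r = "real N powr \<gamma>"]) auto
      also have "\<dots> = 1 - 2 * d N" by (simp add: d_def)
      finally show "?V i + d N \<le> ?V (N - 1)"
        using best elim by linarith
    next
      show "c * real N \<le> (\<Sum>k<N. ?V k)"
        using elim sum_order_stats_ge[of u N, OF u] by simp
    qed (use order_stats_bounds[of u _ N, OF u] c elim in \<open>auto simp: d_def\<close>)
    also have "- (c * d N)\<^sup>2 * real N / 32 = - (c\<^sup>2 / 128) * real N powr (2 * \<epsilon>)"
      using d2[of N] elim by (simp add: mult_ac)
    finally show ?case by (simp add: b_def)
  qed
  have "0 < c\<^sup>2 / 128" using c by simp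
  then show "b \<longlonglongrightarrow> 0"
    unfolding b_def using \<epsilon> by real_asymp
qed

section \<open>Choice of the exponents for almost every sample\<close>

theorem theorem2:
  fixes M :: "'a measure" and U :: "nat \<Rightarrow> 'a \<Rightarrow> real" and \<alpha> :: real
    and Q :: "real \<Rightarrow> real"
  assumes "prob_space M"
    and "prob_space.indep_vars M (\<lambda>_. borel) U UNIV"
    and "\<And>k. distr M borel (U k) = distr M borel (U 0)"
    and "AE \<omega> in M. 0 < U 0 \<omega>"
    and "\<And>x. Q x = measure M {\<omega> \<in> space M. x < U 0 \<omega>}"
    and "Q 1 = 0" and "\<And>x. x < 1 \<Longrightarrow> 0 < Q x"
    and "0 \<le> \<alpha>" and "\<alpha> < 2"
    and "(\<lambda>u. ln (Q (1 - u)) - \<alpha> * ln u) \<in> o[at_right 0](\<lambda>u. ln u)"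
  shows "(\<forall>\<gamma>::real. \<gamma> < 1 - \<alpha> / 2 \<longrightarrow>
            (AE \<omega> in M. (\<lambda>N. quenched_prob N (order_stats (\<lambda>k. U k \<omega>) N)
               (\<lambda>x. \<forall>i\<in>top_players N (real N powr \<gamma>). \<exists>j<N. score N x i < score N x j))
             \<longlonglongrightarrow> 1))
       \<and> (\<forall>\<gamma>::real. \<gamma> > 1 - \<alpha> / 2 \<longrightarrow>
            (AE \<omega> in M. (\<lambda>N. quenched_prob N (order_stats (\<lambda>k. U k \<omega>) N)
               (\<lambda>x. \<forall>i<N. i \<notin> top_players N (real N powr \<gamma>) \<longrightarrow> (\<exists>j<N. score N x i < score N x j)))
             \<longlonglongrightarrow> 1))"
proof -
  interpret prob_space M by fact
  note near_ge = AE_count_near_top_ge[OF assms(2,3,5,7,10)]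
  note near_le = AE_count_near_top_le[OF assms(2,3,5,7,10)]
  have rv[measurable]: "U k \<in> borel_measurable M" for k
    using assms(2) unfolding indep_vars_def by auto
  have "AE \<omega> in M. \<not> 1 < U 0 \<omega>"
  proof -
    have "{\<omega> \<in> space M. 1 < U 0 \<omega>} \<in> null_sets M"
      using assms(5)[of 1] assms(6) by (intro null_setsI) (auto simp: emeasure_eq_measure)
    then show ?thesis by (rule AE_I') auto
  qed
  with assms(4) have "AE \<omega> in M. 0 < U 0 \<omega> \<and> U 0 \<omega> \<le> 1"
    by eventually_elim auto
  \<comment> \<open>The bounds on \<open>U 0\<close> pass through the common law to every
    \<open>U k\<close>, and countability gives them for all \<open>k\<close> at once.\<close>
  then have "AE v in distr M borel (U 0). 0 < v \<and> v \<le> 1"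
    by (subst AE_distr_iff) auto
  then have "AE v in distr M borel (U k). 0 < v \<and> v \<le> 1" for k
    by (simp only: assms(3)[of k])
  then have "AE \<omega> in M. 0 < U k \<omega> \<and> U k \<omega> \<le> 1" for k
    by (subst (asm) AE_distr_iff) auto
  then have bounds: "AE \<omega> in M. \<forall>k. 0 < U k \<omega> \<and> U k \<omega> \<le> 1"
    by (simp add: AE_all_countable)
  \<comment> \<open>With this value, the quarter of the mean count of strengths above 1 / 2 equals
    \<open>2 * c * N\<close>.\<close>
  define c where "c = Q (1 / 2) / 8"
  have c: "0 < c" using assms(7)[of "1 / 2"] by (simp add: c_def)
  have half: "AE \<omega> in M. \<forall>\<^sub>F N in sequentially.
      2 * c * real N \<le> real (card {k. k < N \<and> 1 / 2 < U k \<omega>})"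
    using AE_many_above[OF assms(2,3,5,7,10), of "1 / 2"] by (simp add: c_def)
  show ?thesis
  proof (intro conjI allI impI)
    fix \<gamma> :: real assume \<gamma>: "\<gamma> < 1 - \<alpha> / 2"
    \<comment> \<open>An exponent strictly between \<open>\<gamma>\<close> and
      \<open>1 - \<alpha> / 2\<close>; the maximum with 0 keeps it nonnegative when
      \<open>\<gamma>\<close> is negative.\<close>
    define \<gamma>' where "\<gamma>' = (max \<gamma> 0 + (1 - \<alpha> / 2)) / 2"
    have \<gamma>': "\<gamma> < \<gamma>'" "0 \<le> \<gamma>'" "\<gamma>' < 1 - \<alpha> / 2"
      using \<gamma> assms(9) by (auto simp: \<gamma>'_def max_def field_simps)
    \<comment> \<open>Small enough that
      \<open>\<gamma>' < 1 - \<alpha> * (1 / 2 + \<epsilon>)\<close>; the denominator stays positive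
      also for \<open>\<alpha> = 0\<close>.\<close>
    define \<epsilon> where "\<epsilon> = (1 - \<alpha> / 2 - \<gamma>') / (2 + 2 * \<alpha>)"
    have \<epsilon>: "0 < \<epsilon>" using \<gamma>' assms(8) by (simp add: \<epsilon>_def)
    have "\<alpha> * \<epsilon> < 1 - \<alpha> / 2 - \<gamma>'"
    proof -
      have "(2 + 2 * \<alpha>) * \<epsilon> = 1 - \<alpha> / 2 - \<gamma>'" using assms(8) by (simp add: \<epsilon>_def)
      moreover have "\<alpha> * \<epsilon> < (2 + 2 * \<alpha>) * \<epsilon>" using \<epsilon> assms(8) by (intro mult_strict_right_mono) auto
      ultimately show ?thesis by simp
    qed
    then have "\<gamma>' < 1 - \<alpha> * (1 / 2 + \<epsilon>)" by (simp add: distrib_left)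
    with \<epsilon> \<gamma>' have "AE \<omega> in M. \<forall>\<^sub>F N in sequentially.
       real N powr \<gamma>' \<le> real (card {k. k < N \<and> 1 - real N powr (- (1 / 2 + \<epsilon>)) < U k \<omega>})"
      by (intro near_ge) auto
    with bounds half show "AE \<omega> in M. (\<lambda>N. quenched_prob N (order_stats (\<lambda>k. U k \<omega>) N)
               (\<lambda>x. \<forall>i\<in>top_players N (real N powr \<gamma>). \<exists>j<N. score N x i < score N x j))
             \<longlonglongrightarrow> 1"
    proof eventually_elim
      case (elim \<omega>)
      show ?case
        by (rule top_players_lose[OF _ _ c elim(2,3) \<epsilon> \<gamma>'(1)]) (use elim(1) in auto)
    qed
  next
    fix \<gamma> :: real assume \<gamma>: "1 - \<alpha> / 2 < \<gamma>"
    \<comment> \<open>The bound 1 / 4 keeps the scale \<open>1 / 2 - \<epsilon>\<close> positive,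
      the other one ensures \<open>1 - \<alpha> * (1 / 2 - \<epsilon>) < \<gamma>\<close>.\<close>
    define \<epsilon> where "\<epsilon> = min (1 / 4) ((\<gamma> - (1 - \<alpha> / 2)) / (2 + 2 * \<alpha>))"
    have \<epsilon>: "0 < \<epsilon>" using \<gamma> assms(8) by (simp add: \<epsilon>_def)
    have "\<epsilon> \<le> 1 / 4" unfolding \<epsilon>_def by (rule min.cobounded1)
    then have \<epsilon>': "0 < 1 / 2 - \<epsilon>" by simp
    have "\<alpha> * \<epsilon> < \<gamma> - (1 - \<alpha> / 2)"
    proof -
      have "(2 + 2 * \<alpha>) * \<epsilon> \<le> (2 + 2 * \<alpha>) * ((\<gamma> - (1 - \<alpha> / 2)) / (2 + 2 * \<alpha>))"
        using assms(8) by (intro mult_left_mono) (auto simp: \<epsilon>_def)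
      also have "\<dots> = \<gamma> - (1 - \<alpha> / 2)" using assms(8) by simp
      finally have "(2 + 2 * \<alpha>) * \<epsilon> \<le> \<gamma> - (1 - \<alpha> / 2)" .
      moreover have "\<alpha> * \<epsilon> < (2 + 2 * \<alpha>) * \<epsilon>" using \<epsilon> assms(8) by (intro mult_strict_right_mono) auto
      ultimately show ?thesis by simp
    qed
    then have "1 - \<alpha> * (1 / 2 - \<epsilon>) < \<gamma>" by (simp add: right_diff_distrib)
    moreover have "0 < \<gamma>" using \<gamma> assms(9) by simp
    ultimately have few: "AE \<omega> in M. \<forall>\<^sub>F N in sequentially.
       real (card {k. k < N \<and> 1 - real N powr (- (1 / 2 - \<epsilon>)) < U k \<omega>}) \<le> real N powr \<gamma>"
      using \<epsilon>' by (intro near_le) auto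
    have "AE \<omega> in M. \<forall>\<^sub>F N in sequentially.
       real N powr 0 \<le> real (card {k. k < N \<and> 1 - real N powr (- (1 / 2)) < U k \<omega>})"
      using assms(9) by (intro near_ge) auto
    then have "AE \<omega> in M. \<forall>\<^sub>F N in sequentially.
       1 \<le> real (card {k. k < N \<and> 1 - real N powr (- (1 / 2)) < U k \<omega>})"
    proof eventually_elim
      case (elim \<omega>)
      \<comment> \<open>Since \<open>0 powr 0\<close> is 0, the bound \<open>N powr 0\<close> equals
        1 only for positive \<open>N\<close>.\<close>
      then show ?case using eventually_gt_at_top[of 0] by eventually_elim simp
    qed
    with bounds half few show "AE \<omega> in M. (\<lambda>N. quenched_prob N (order_stats (\<lambda>k. U k \<omega>) N)
               (\<lambda>x. \<forall>i<N. i \<notin> top_players N (real N powr \<gamma>) \<longrightarrow> (\<exists>j<N. score N x i < score N x j)))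
             \<longlonglongrightarrow> 1"
    proof eventually_elim
      case (elim \<omega>)
      have "(\<lambda>N. quenched_prob N (order_stats (\<lambda>k. U k \<omega>) N)
         (\<lambda>x. \<forall>i\<in>{i. i < N \<and> i \<notin> top_players N (real N powr \<gamma>)}. \<exists>j<N. score N x i < score N x j))
           \<longlonglongrightarrow> 1"
        by (rule top_players_win[OF _ _ c elim(2,4,3) \<epsilon>]) (use elim(1) in auto)
      then show ?case by (simp add: imp_conjL)
    qed
  qed
qed

end
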